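(* Let $\Gamma$ be a semigroup of maps $\mathbb{Z}^d \to \mathbb{Z}^d$, and suppose there is a finite set $\{s_1, \ldots, s_r\}$ of polynomial walks in $\Gamma$ such that $\{s_j(n) : n \geq 0,\ j = 1, \ldots, r\}$ generates $\Gamma$. Let $T : \mathbb{Z}^d \curvearrowright (X, \mu)$ be a measure preserving action on a probability space. Then for every measurable $B \subset X$ with $\mu(B) > 0$, every integer $m \geq 1$ and every $\epsilon > 0$, there exists a positive integer $k = k(B, m, \epsilon)$ such that: whenever $v_1, \ldots, v_m \in k\mathbb{Z}^d$ are such that each orbit $\Gamma v_i$ is hyperplane-fleeing, there exist $\gamma_1, \ldots, \gamma_m \in \Gamma$ with $$\mu\big(B \cap T^{-\gamma_1 v_1} B \cap \cdots \cap T^{-\gamma_m v_m} B\big) > \mu(B)^{m+1} - \epsilon.$$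
   Context: A polynomial walk in a semigroup $\Gamma$ of maps $\mathbb{Z}^d \to \mathbb{Z}^d$ is a map $s : \mathbb{Z}_{\geq 0} \to \Gamma$ such that (1) there are polynomials $q_1, \ldots, q_d \in \mathbb{Z}[t_1, \ldots, t_{d+1}]$ with $s(n)x = (q_1(n, x_1, \ldots, x_d), \ldots, q_d(n, x_1, \ldots, x_d))$ for all $x \in \mathbb{Z}^d$ and $n \geq 0$, and (2) $s(0)$ is the identity map. A set $A \subset \mathbb{R}^d$ is hyperplane-fleeing if it is not contained in any proper affine subspace of $\mathbb{R}^d$. $T^v$ ($v\in\mathbb{Z}^d$) denotes the measure-preserving transformation of $X$ associated to $v$. *)

theory Defs
  imports "HOL-Probability.Probability"
begin

inductive int_poly_fun :: "(('v \<Rightarrow> int) \<Rightarrow> int) \<Rightarrow> bool" where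
  const: "int_poly_fun (\<lambda>x. c)"
| var: "int_poly_fun (\<lambda>x. x i)"
| add: "int_poly_fun p \<Longrightarrow> int_poly_fun q \<Longrightarrow> int_poly_fun (\<lambda>x. p x + q x)"
| mult: "int_poly_fun p \<Longrightarrow> int_poly_fun q \<Longrightarrow> int_poly_fun (\<lambda>x. p x * q x)"

definition polynomial_walk :: "(nat \<Rightarrow> (int ^ 'd \<Rightarrow> int ^ 'd)) \<Rightarrow> bool" where
  "polynomial_walk s \<longleftrightarrow>
     (\<forall>i. \<exists>q :: ('d option \<Rightarrow> int) \<Rightarrow> int. int_poly_fun q \<and>
        (\<forall>n x. (s n x) $ i = q (\<lambda>j. case j of None \<Rightarrow> int n | Some l \<Rightarrow> x $ l)))
     \<and> s 0 = id"

inductive_set gen_semigroup :: "('a \<Rightarrow> 'a) set \<Rightarrow> ('a \<Rightarrow> 'a) set" for S where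
  base: "f \<in> S \<Longrightarrow> f \<in> gen_semigroup S"
| comp: "f \<in> gen_semigroup S \<Longrightarrow> g \<in> gen_semigroup S \<Longrightarrow> f \<circ> g \<in> gen_semigroup S"

definition hyperplane_fleeing :: "(real ^ 'd) set \<Rightarrow> bool" where
  "hyperplane_fleeing A \<longleftrightarrow> \<not> (\<exists>S. affine S \<and> S \<noteq> UNIV \<and> A \<subseteq> S)"

definition real_of_intvec :: "int ^ 'd \<Rightarrow> real ^ 'd" where
  "real_of_intvec v = (\<chi> i. real_of_int (v $ i))"

definition mp_action :: "'a measure \<Rightarrow> (int ^ 'd \<Rightarrow> 'a \<Rightarrow> 'a) \<Rightarrow> bool" where
  "mp_action M T \<longleftrightarrow>
     (\<forall>v. T v \<in> M \<rightarrow>\<^sub>M M \<and> distr M M (T v) = M) \<and>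
     (\<forall>x\<in>space M. T 0 x = x) \<and>
     (\<forall>u v. \<forall>x\<in>space M. T (u + v) x = T u (T v x))"

end

theory Submission
  imports Defs "HOL-Library.Function_Algebras"
begin

text \<open>
  Write \<open>U\<^sub>w f = f \<circ> T\<^sup>w\<close>. Everything takes place among convex combinations of the \<open>U\<^sub>w f\<close>, where
  \<open>f = 1\<^sub>B\<close>. Let \<open>\<rho>(k)\<close> be the infimum of the \<open>L\<^sup>2\<close>-norms of the combinations with all \<open>w \<in> k\<int>\<^sup>d\<close>, choose \<open>k\<close>
  with \<open>\<rho>(k)\<close> close to the supremum over all \<open>k\<close>, and let \<open>g\<close> be a nearly minimal combination. By the
  parallelogram law \<open>g\<close> is nearly invariant under \<open>k\<int>\<^sup>d\<close>, and every other nearly minimal combination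
  is close to \<open>g\<close>; so \<open>g\<close> replaces a conditional expectation.

  If \<open>\<Gamma>v\<close> is hyperplane-fleeing and \<open>v \<in> k\<int>\<^sup>d\<close>, then \<open>\<Gamma>v \<inter> k\<int>\<^sup>d\<close> contains a polynomial curve
  \<open>P(t) = \<Sum>\<^sub>j t\<^sup>j c\<^sub>j\<close> for which the \<open>c\<^sub>j\<close> with \<open>j \<ge> 1\<close> span: concatenate walks through finitely many
  affinely spanning points of the orbit, with times prescribed by Lagrange interpolation. By van der
  Corput differencing the averages of \<open>U\<^bsub>P(Qt)\<^esub> f\<close> have, for suitable \<open>Q\<close>, norm at most about that of a
  combination that is nearly invariant under some \<open>k'\<int>\<^sup>d\<close>, hence at most about \<open>\<rho>(k') \<le> sup \<rho>\<close>. They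
  are therefore nearly minimal, and so close to \<open>g\<close>. Averaging over one curve for each \<open>v\<^sub>i\<close> turns the
  multiple correlation into about \<open>\<integral>f g\<^sup>m \<approx> \<integral>g\<^sup>m\<^sup>+\<^sup>1 \<ge> \<mu>(B)\<^sup>m\<^sup>+\<^sup>1\<close>.
\<close>

section \<open>Vector polynomials and sublattices\<close>

definition vpoly :: "(nat \<Rightarrow> int ^ 'd) \<Rightarrow> nat \<Rightarrow> int \<Rightarrow> int ^ 'd" where
  "vpoly c D t = (\<Sum>l\<le>D. t ^ l *s c l)"

lemma vpoly_Suc: "vpoly c (Suc D) t = vpoly c D t + t ^ Suc D *s c (Suc D)"
  by (simp add: vpoly_def)

text \<open>Binomial expansion. The two leading coefficients are recorded because they decide the
  leading coefficient of a difference of two shifts.\<close>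

lemma vpoly_shift:
  obtains e where "\<And>t. vpoly c (Suc D) (t + i) = vpoly e (Suc D) t"
    "e (Suc D) = c (Suc D)" "e D = c D + (int (Suc D) * i) *s c (Suc D)"
proof
  let ?e = "\<lambda>l. \<Sum>j\<le>Suc D. (of_nat (j choose l) * i ^ (j - l)) *s c j"
  show "vpoly c (Suc D) (t + i) = vpoly ?e (Suc D) t" for t
  proof -
    have "(t + i) ^ j = (\<Sum>l\<le>Suc D. of_nat (j choose l) * t ^ l * i ^ (j - l))" if "j \<le> Suc D" for j
      unfolding binomial_ring using that by (intro sum.mono_neutral_left) auto
    then have "vpoly c (Suc D) (t + i)
        = (\<Sum>j\<le>Suc D. (\<Sum>l\<le>Suc D. of_nat (j choose l) * t ^ l * i ^ (j - l)) *s c j)"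
      unfolding vpoly_def by (intro sum.cong) auto
    also have "\<dots> = vpoly ?e (Suc D) t"
      unfolding vpoly_def vec_eq_iff
    proof
      fix a
      show "(\<Sum>j\<le>Suc D. (\<Sum>l\<le>Suc D. of_nat (j choose l) * t ^ l * i ^ (j - l)) *s c j) $ a
        = (\<Sum>l\<le>Suc D. t ^ l *s ?e l) $ a"
        unfolding sum_component vector_smult_component sum_distrib_left sum_distrib_right
        by (subst sum.swap) (simp only: mult.assoc mult.left_commute)
    qed
    finally show ?thesis .
  qed
  have 0: "(\<Sum>j<D. (of_nat (j choose l) * i ^ (j - l)) *s c j) = 0" if "l \<ge> D" for l
    using that by (intro sum.neutral) auto
  have split: "?e l = (\<Sum>j<D. (of_nat (j choose l) * i ^ (j - l)) *s c j)
      + (of_nat (D choose l) * i ^ (D - l)) *s c D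
      + (of_nat (Suc D choose l) * i ^ (Suc D - l)) *s c (Suc D)" for l
    by (simp flip: lessThan_Suc_atMost)
  show "?e (Suc D) = c (Suc D)"
    unfolding split 0[of "Suc D", OF le_SucI[OF order_refl]] by simp
  show "?e D = c D + (int (Suc D) * i) *s c (Suc D)"
    unfolding split 0[OF order_refl] by simp
qed

text \<open>The top coefficients of the two shifts agree and cancel. What leads afterwards is an
  integer multiple of the old top coefficient, with a nonzero factor when
  \<open>i \<noteq> j\<close>; this drives the induction on the degree in
  \<open>Weyl_vanish\<close>.\<close>

lemma vpoly_diff:
  obtains e where "\<And>t. vpoly c (Suc D) (t + i) - vpoly c (Suc D) (t + j) = vpoly e D t"
    "e D = (int (Suc D) * (i - j)) *s c (Suc D)"
proof -
  obtain e1 where e1: "\<And>t. vpoly c (Suc D) (t + i) = vpoly e1 (Suc D) t"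
    "e1 (Suc D) = c (Suc D)" "e1 D = c D + (int (Suc D) * i) *s c (Suc D)"
    using vpoly_shift[of c D i] by blast
  obtain e2 where e2: "\<And>t. vpoly c (Suc D) (t + j) = vpoly e2 (Suc D) t"
    "e2 (Suc D) = c (Suc D)" "e2 D = c D + (int (Suc D) * j) *s c (Suc D)"
    using vpoly_shift[of c D j] by blast
  show thesis
  proof
    show "vpoly c (Suc D) (t + i) - vpoly c (Suc D) (t + j) = vpoly (\<lambda>l. e1 l - e2 l) D t" for t
    proof -
      have "vpoly (\<lambda>l. e1 l - e2 l) D t = vpoly e1 D t - vpoly e2 D t"
        by (simp add: vpoly_def vec_eq_iff right_diff_distrib sum_subtractf)
      then show ?thesis unfolding e1(1) e2(1) by (simp add: vpoly_Suc e1(2) e2(2))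
    qed
    show "e1 D - e2 D = (int (Suc D) * (i - j)) *s c (Suc D)"
      by (simp add: e1 e2 vec_eq_iff algebra_simps)
  qed
qed

definition mult_lattice :: "nat \<Rightarrow> (int ^ 'd) set" where
  "mult_lattice k = {w. \<forall>l. int k dvd w $ l}"

lemma mult_lattice_add: "u \<in> mult_lattice k \<Longrightarrow> w \<in> mult_lattice k \<Longrightarrow> u + w \<in> mult_lattice k"
  by (simp add: mult_lattice_def)

lemma mult_lattice_ne: "mult_lattice k \<noteq> {}"
proof -
  have "0 \<in> mult_lattice k" by (simp add: mult_lattice_def)
  then show ?thesis by blast
qed

lemma mult_lattice_mult:
  assumes "w \<in> mult_lattice (a * b)"
  obtains v where "v \<in> mult_lattice b" "w = int a *s v"
proof
  show "(\<chi> l. w $ l div int a) \<in> mult_lattice b"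
    unfolding mult_lattice_def
  proof (clarsimp)
    fix l
    have "int (a * b) dvd w $ l" using assms by (simp add: mult_lattice_def)
    then obtain m where "w $ l = int (a * b) * m" by (rule dvdE)
    then show "int b dvd w $ l div int a" by (cases "a = 0") auto
  qed
  have "int a dvd w $ l" for l using assms by (auto simp: mult_lattice_def dest: dvd_mult_left)
  then show "w = int a *s (\<chi> l. w $ l div int a)" by (simp add: vec_eq_iff)
qed

section \<open>Polynomial averages of commuting isometries\<close>

text \<open>The form is only positive semidefinite on \<open>V\<close>, and completeness is not
  assumed, so bounded functions qualify without passing to classes modulo null sets. Near minimisers
  of the norm stand in for orthogonal projections.\<close>

locale isometric_action =
  fixes V :: "'v::real_vector set"
    and ip :: "'v \<Rightarrow> 'v \<Rightarrow> real"
    and U :: "int ^ 'd \<Rightarrow> 'v \<Rightarrow> 'v"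
  assumes V_subspace: "subspace V"
    and ip_commute: "ip x y = ip y x"
    and ip_add_left: "x \<in> V \<Longrightarrow> y \<in> V \<Longrightarrow> z \<in> V \<Longrightarrow> ip (x + y) z = ip x z + ip y z"
    and ip_scale_left: "x \<in> V \<Longrightarrow> y \<in> V \<Longrightarrow> ip (a *\<^sub>R x) y = a * ip x y"
    and ip_nonneg: "x \<in> V \<Longrightarrow> 0 \<le> ip x x"
    and U_linear: "linear (U w)"
    and U_in: "x \<in> V \<Longrightarrow> U w x \<in> V"
    and U_add: "U (u + w) x = U u (U w x)"
    and U_zero: "x \<in> V \<Longrightarrow> U 0 x = x"
    and ip_U: "x \<in> V \<Longrightarrow> y \<in> V \<Longrightarrow> ip (U w x) (U w y) = ip x y"
begin

section \<open>The seminorm of the form\<close>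

definition nrm :: "'v \<Rightarrow> real" where "nrm x = sqrt (ip x x)"

lemma V_closed [simp, intro]:
  "0 \<in> V" "x \<in> V \<Longrightarrow> y \<in> V \<Longrightarrow> x + y \<in> V" "x \<in> V \<Longrightarrow> y \<in> V \<Longrightarrow> x - y \<in> V"
  "x \<in> V \<Longrightarrow> a *\<^sub>R x \<in> V" "x \<in> V \<Longrightarrow> - x \<in> V" "x \<in> V \<Longrightarrow> U w x \<in> V"
  using V_subspace by (auto intro: subspace_0 subspace_add subspace_diff subspace_scale subspace_neg U_in)

lemma V_sum [simp, intro]: "(\<And>i. i \<in> I \<Longrightarrow> g i \<in> V) \<Longrightarrow> sum g I \<in> V"
  by (rule subspace_sum[OF V_subspace])

lemma U_lin: "U w (x + y) = U w x + U w y" "U w (x - y) = U w x - U w y"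
  "U w (a *\<^sub>R x) = a *\<^sub>R U w x" "U w (sum g I) = (\<Sum>i\<in>I. U w (g i))"
  using U_linear[of w] by (simp_all add: linear_add linear_diff linear_scale linear_sum)

lemma ip_add_right: "x \<in> V \<Longrightarrow> y \<in> V \<Longrightarrow> z \<in> V \<Longrightarrow> ip z (x + y) = ip z x + ip z y"
  by (metis ip_add_left ip_commute)

lemma ip_scale_right: "x \<in> V \<Longrightarrow> y \<in> V \<Longrightarrow> ip y (a *\<^sub>R x) = a * ip y x"
  by (metis ip_scale_left ip_commute)

lemma ip_minus_left: "x \<in> V \<Longrightarrow> y \<in> V \<Longrightarrow> ip (- x) y = - ip x y"
  using ip_scale_left[of x y "-1"] by simp

lemma ip_diff_left: "x \<in> V \<Longrightarrow> y \<in> V \<Longrightarrow> z \<in> V \<Longrightarrow> ip (x - y) z = ip x z - ip y z"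
  using ip_add_left[of x "- y" z] by (simp add: ip_minus_left)

lemma ip_diff_right: "x \<in> V \<Longrightarrow> y \<in> V \<Longrightarrow> z \<in> V \<Longrightarrow> ip z (x - y) = ip z x - ip z y"
  by (metis ip_diff_left ip_commute)

lemma ip_zero_left: "x \<in> V \<Longrightarrow> ip 0 x = 0"
  using ip_scale_left[of 0 x 0] by simp

lemma ip_sum_left:
  assumes "\<And>i. i \<in> I \<Longrightarrow> g i \<in> V" "y \<in> V"
  shows "ip (sum g I) y = (\<Sum>i\<in>I. ip (g i) y)"
  using assms by (induction I rule: infinite_finite_induct) (auto simp: ip_zero_left ip_add_left)

lemma ip_sum_right:
  assumes "\<And>i. i \<in> I \<Longrightarrow> g i \<in> V" "y \<in> V"
  shows "ip y (sum g I) = (\<Sum>i\<in>I. ip y (g i))"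
  using ip_sum_left[OF assms] by (simp add: ip_commute)

lemma nrm_nonneg: "x \<in> V \<Longrightarrow> 0 \<le> nrm x"
  by (simp add: nrm_def ip_nonneg)

lemma nrm_square: "x \<in> V \<Longrightarrow> (nrm x)\<^sup>2 = ip x x"
  by (simp add: nrm_def ip_nonneg)

lemma nrm_scale: "x \<in> V \<Longrightarrow> nrm (a *\<^sub>R x) = \<bar>a\<bar> * nrm x"
proof -
  assume "x \<in> V"
  then have "ip (a *\<^sub>R x) (a *\<^sub>R x) = a\<^sup>2 * ip x x"
    by (simp add: ip_scale_left ip_scale_right power2_eq_square)
  then show ?thesis by (simp add: nrm_def real_sqrt_mult)
qed

lemma nrm_zero: "nrm 0 = 0"
  by (simp add: nrm_def ip_zero_left)

lemma nrm_U: "x \<in> V \<Longrightarrow> nrm (U w x) = nrm x"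
  by (simp add: nrm_def ip_U)

lemma nrm_minus_commute: "x \<in> V \<Longrightarrow> y \<in> V \<Longrightarrow> nrm (x - y) = nrm (y - x)"
  using nrm_scale[of "x - y" "-1"] by simp

lemma Cauchy_Schwarz:
  assumes [simp]: "x \<in> V" "y \<in> V"
  shows "\<bar>ip x y\<bar> \<le> nrm x * nrm y"
proof -
  have q: "0 \<le> ip x x - 2 * a * ip x y + a\<^sup>2 * ip y y" for a
  proof -
    have "0 \<le> ip (x - a *\<^sub>R y) (x - a *\<^sub>R y)" by (simp add: ip_nonneg)
    also have "\<dots> = ip x x - 2 * a * ip x y + a\<^sup>2 * ip y y"
      by (simp add: ip_diff_left ip_diff_right ip_scale_left ip_scale_right ip_commute[of y x]
          power2_eq_square algebra_simps)
    finally show ?thesis .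
  qed
  have "(ip x y)\<^sup>2 \<le> ip x x * ip y y"
  proof (cases "ip y y = 0")
    case True
    have "ip x y = 0"
    proof (rule ccontr)
      assume ne: "ip x y \<noteq> 0"
      \<comment> \<open>With \<open>ip y y = 0\<close> the quadratic is affine in \<open>a\<close>,
        and this choice of \<open>a\<close> gives it the value -1.\<close>
      show False using q[of "(ip x x + 1) / (2 * ip x y)"] True ne by simp
    qed
    then show ?thesis by (simp add: True)
  next
    case False
    then have pos: "0 < ip y y" using ip_nonneg[of y] by simp
    have "0 \<le> ip x x - (ip x y)\<^sup>2 / ip y y"
      using q[of "ip x y / ip y y"] pos by (simp add: power2_eq_square field_simps)
    then show ?thesis using pos by (simp add: field_simps)
  qed
  then have "sqrt ((ip x y)\<^sup>2) \<le> sqrt (ip x x * ip y y)" by (rule real_sqrt_le_mono)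
  then show ?thesis by (simp add: nrm_def real_sqrt_mult)
qed

lemma nrm_triangle:
  assumes [simp]: "x \<in> V" "y \<in> V"
  shows "nrm (x + y) \<le> nrm x + nrm y"
proof (rule power2_le_imp_le)
  have "(nrm (x + y))\<^sup>2 = (nrm x)\<^sup>2 + 2 * ip x y + (nrm y)\<^sup>2"
    by (simp add: nrm_square ip_add_left ip_add_right ip_commute[of y x])
  also have "\<dots> \<le> (nrm x + nrm y)\<^sup>2"
    using Cauchy_Schwarz[of x y] by (simp add: power2_sum)
  finally show "(nrm (x + y))\<^sup>2 \<le> (nrm x + nrm y)\<^sup>2" .
qed (simp add: nrm_nonneg)

lemma nrm_triangle_diff: "x \<in> V \<Longrightarrow> y \<in> V \<Longrightarrow> nrm x \<le> nrm y + nrm (x - y)"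
  using nrm_triangle[of y "x - y"] by simp

lemma nrm_triangle_diff2:
  "x \<in> V \<Longrightarrow> y \<in> V \<Longrightarrow> z \<in> V \<Longrightarrow> nrm (x - z) \<le> nrm (x - y) + nrm (y - z)"
  using nrm_triangle[of "x - y" "y - z"] by simp

lemma nrm_sum:
  assumes "\<And>i. i \<in> I \<Longrightarrow> g i \<in> V"
  shows "nrm (sum g I) \<le> (\<Sum>i\<in>I. nrm (g i))"
  using assms
proof (induction I rule: infinite_finite_induct)
  case (insert i I)
  then have "nrm (g i + sum g I) \<le> nrm (g i) + nrm (sum g I)" by (intro nrm_triangle) auto
  with insert show ?case by force
qed (auto simp: nrm_zero)

lemma parallelogram:
  assumes [simp]: "x \<in> V" "y \<in> V"
  shows "(nrm (x - y))\<^sup>2 = 2 * (nrm x)\<^sup>2 + 2 * (nrm y)\<^sup>2 - 4 * (nrm ((1/2) *\<^sub>R x + (1/2) *\<^sub>R y))\<^sup>2"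
  by (simp add: nrm_square ip_add_left ip_add_right ip_diff_left ip_diff_right
      ip_scale_left ip_scale_right ip_commute[of y x] field_simps)

section \<open>Convex combinations of the isometries\<close>

text \<open>The convex hull of the operators \<open>U w\<close> with \<open>w \<in> L\<close>.
  Building it from two-term combinations makes induction available for every property that is stable
  under them.\<close>

inductive_set Av :: "(int ^ 'd) set \<Rightarrow> ('v \<Rightarrow> 'v) set" for L where
  U: "w \<in> L \<Longrightarrow> U w \<in> Av L"
| cvx: "A \<in> Av L \<Longrightarrow> B \<in> Av L \<Longrightarrow> 0 \<le> a \<Longrightarrow> a \<le> 1 \<Longrightarrow>
    (\<lambda>x. a *\<^sub>R A x + (1 - a) *\<^sub>R B x) \<in> Av L"

lemma Av_mono: "A \<in> Av L \<Longrightarrow> L \<subseteq> L' \<Longrightarrow> A \<in> Av L'"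
  by (induction rule: Av.induct) (auto intro: Av.intros)

lemma Av_linear: "A \<in> Av L \<Longrightarrow> linear A"
proof (induction rule: Av.induct)
  case (cvx A B a)
  have "linear (\<lambda>x. a *\<^sub>R A x + (1 - a) *\<^sub>R B x)"
    using cvx by (intro linear_compose_add linear_compose_scale_right) auto
  then show ?case .
qed (rule U_linear)

lemma Av_lin:
  assumes "A \<in> Av L"
  shows "A (x + y) = A x + A y" "A (x - y) = A x - A y" "A (a *\<^sub>R x) = a *\<^sub>R A x"
    "A (sum g I) = (\<Sum>i\<in>I. A (g i))"
  using Av_linear[OF assms] by (simp_all add: linear_add linear_diff linear_scale linear_sum)

lemma Av_in [simp, intro]: "A \<in> Av L \<Longrightarrow> x \<in> V \<Longrightarrow> A x \<in> V"
  by (induction rule: Av.induct) auto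

lemma nrm_cvx:
  assumes "x \<in> V" "y \<in> V" "0 \<le> a" "a \<le> 1" "nrm x \<le> r" "nrm y \<le> r"
  shows "nrm (a *\<^sub>R x + (1 - a) *\<^sub>R y) \<le> r"
proof -
  have "nrm (a *\<^sub>R x + (1 - a) *\<^sub>R y) \<le> a * nrm x + (1 - a) * nrm y"
    using assms nrm_triangle[of "a *\<^sub>R x" "(1 - a) *\<^sub>R y"] by (simp add: nrm_scale)
  also have "\<dots> \<le> a * r + (1 - a) * r" using assms by (intro add_mono mult_left_mono) auto
  finally show ?thesis by (simp add: algebra_simps)
qed

lemma Av_nrm: "A \<in> Av L \<Longrightarrow> x \<in> V \<Longrightarrow> nrm (A x) \<le> nrm x"
  by (induction rule: Av.induct) (auto simp: nrm_U intro!: nrm_cvx)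

lemma Av_near_invariant:
  assumes "A \<in> Av L" "x \<in> V" "\<And>w. w \<in> L \<Longrightarrow> nrm (U w x - x) \<le> e"
  shows "nrm (A x - x) \<le> e"
  using assms
proof (induction rule: Av.induct)
  case (cvx A B a)
  have "a *\<^sub>R A x + (1 - a) *\<^sub>R B x - x = a *\<^sub>R (A x - x) + (1 - a) *\<^sub>R (B x - x)"
    by (simp add: algebra_simps)
  then show ?case using cvx by (auto intro!: nrm_cvx)
qed auto

lemma U_Av_commute: "A \<in> Av L \<Longrightarrow> U w (A x) = A (U w x)"
proof (induction rule: Av.induct)
  case (U u) show ?case by (metis U_add add.commute)
qed (simp add: U_lin)

lemma Av_commute: "A \<in> Av L \<Longrightarrow> B \<in> Av L' \<Longrightarrow> A (B x) = B (A x)"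
  by (induction rule: Av.induct) (simp_all add: U_Av_commute Av_lin)

lemma Av_comp:
  assumes "A \<in> Av L" "B \<in> Av L'" "\<And>u w. u \<in> L \<Longrightarrow> w \<in> L' \<Longrightarrow> u + w \<in> L''"
  shows "(\<lambda>x. A (B x)) \<in> Av L''"
  using assms(1)
proof (induction rule: Av.induct)
  case (U u)
  from assms(2) show ?case
  proof (induction rule: Av.induct)
    case (U w)
    then have "U (u + w) \<in> Av L''" using assms(3) \<open>u \<in> L\<close> by (auto intro: Av.U)
    then show ?case by (simp add: U_add[abs_def])
  next
    case (cvx A B a)
    have "(\<lambda>x. a *\<^sub>R U u (A x) + (1 - a) *\<^sub>R U u (B x)) \<in> Av L''"
      using cvx by (intro Av.cvx) auto
    then show ?case by (simp add: U_lin)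
  qed
qed (rule Av.cvx)

section \<open>Time averages and van der Corput differencing\<close>

definition avg :: "(nat \<Rightarrow> int ^ 'd) \<Rightarrow> nat \<Rightarrow> 'v \<Rightarrow> 'v" where
  "avg P N x = (1 / real N) *\<^sub>R (\<Sum>t<N. U (P t) x)"

lemma avg_in_Av:
  assumes "N > 0"
  shows "avg P N \<in> Av (range P)"
  using assms
proof (induction N rule: nat_induct_non_zero)
  case 1
  show ?case using Av.U[of "P 0" "range P"] by (simp add: avg_def[abs_def])
next
  case (Suc n)
  have "avg P (Suc n) = (\<lambda>x. (n / (n + 1)) *\<^sub>R avg P n x + (1 - n / (n + 1)) *\<^sub>R U (P n) x)"
  proof
    fix x
    have "1 - real n / (real n + 1) = 1 / (real n + 1)" by (simp add: field_simps)
    then show "avg P (Suc n) x = (n / (n + 1)) *\<^sub>R avg P n x + (1 - n / (n + 1)) *\<^sub>R U (P n) x"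
      using Suc.hyps by (simp add: avg_def scaleR_add_right add.commute)
  qed
  then show ?case using Suc by (auto intro!: Av.intros)
qed

lemma avg_lin: "avg P N (x - y) = avg P N x - avg P N y" "avg P N (a *\<^sub>R x) = a *\<^sub>R avg P N x"
  by (simp_all add: avg_def U_lin sum_subtractf scaleR_diff_right scaleR_sum_right ac_simps)

lemma avg_in [simp, intro]: "x \<in> V \<Longrightarrow> avg P N x \<in> V"
  by (auto simp: avg_def)

lemma avg_nrm: "x \<in> V \<Longrightarrow> N > 0 \<Longrightarrow> nrm (avg P N x) \<le> nrm x"
  using avg_in_Av Av_nrm by blast

lemma nrm_mean_le:
  assumes "\<And>t. t < N \<Longrightarrow> g t \<in> V" "\<And>t. t < N \<Longrightarrow> nrm (g t) \<le> r" "0 \<le> r"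
  shows "nrm ((1 / real N) *\<^sub>R (\<Sum>t<N. g t)) \<le> r"
proof -
  have "nrm (\<Sum>t<N. g t) \<le> (\<Sum>t<N. nrm (g t))" using assms by (intro nrm_sum) auto
  also have "\<dots> \<le> (\<Sum>t<N. r)" using assms by (intro sum_mono) auto
  finally have "nrm (\<Sum>t<N. g t) \<le> N * r" by simp
  moreover have "(\<Sum>t<N. g t) \<in> V" using assms by (intro V_sum) auto
  ultimately show ?thesis using assms
    by (cases "N = 0") (auto simp: nrm_zero nrm_scale field_simps)
qed

text \<open>Each unit shift drops one term and adds one, at a cost of at most
  \<open>2 * C\<close>.\<close>

lemma shift_sum:
  assumes "\<And>t. x t \<in> V" "\<And>t. nrm (x t) \<le> C"
  shows "nrm ((\<Sum>t<N. x (t + h)) - (\<Sum>t<N. x t)) \<le> 2 * real h * C"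
proof (induction h)
  case 0 show ?case by (simp add: nrm_zero)
next
  case (Suc h)
  have "(\<Sum>t<N. x (t + Suc h)) = (\<Sum>t<N. x (t + h)) + (x (N + h) - x h)"
    by (induction N) (auto simp: algebra_simps)
  then have "(\<Sum>t<N. x (t + Suc h)) - (\<Sum>t<N. x t)
      = ((\<Sum>t<N. x (t + h)) - (\<Sum>t<N. x t)) + (x (N + h) - x h)" by simp
  also have "nrm \<dots> \<le> nrm ((\<Sum>t<N. x (t + h)) - (\<Sum>t<N. x t)) + nrm (x (N + h) - x h)"
    using assms by (intro nrm_triangle) auto
  also have "nrm (x (N + h) - x h) \<le> 2 * C"
    using nrm_triangle[of "x (N + h)" "- x h"] assms(2)[of "N + h"] assms(2)[of h] assms(1)
      nrm_scale[of "x h" "-1"] by simp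
  finally show ?case using Suc by (simp add: algebra_simps)
qed

lemma shift_mean:
  assumes "\<And>t. x t \<in> V" "\<And>t. nrm (x t) \<le> C" "e > 0"
  shows "\<forall>\<^sub>F N in sequentially. nrm ((1 / real N) *\<^sub>R (\<Sum>t<N. x (t + h)) - (1 / real N) *\<^sub>R (\<Sum>t<N. x t)) \<le> e"
proof -
  have "((\<lambda>N. 2 * real h * C / real N) \<longlongrightarrow> 0) sequentially"
    by (rule lim_const_over_n)
  then have "\<forall>\<^sub>F N in sequentially. 2 * real h * C / real N < e"
    using assms(3) by (rule order_tendstoD)
  then show ?thesis using eventually_gt_at_top[of 0]
  proof eventually_elim
    case (elim N)
    let ?d = "(\<Sum>t<N. x (t + h)) - (\<Sum>t<N. x t)"
    have "nrm ((1 / real N) *\<^sub>R ?d) = (1 / real N) * nrm ?d"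
      using assms(1) by (subst nrm_scale) auto
    also have "\<dots> \<le> (1 / real N) * (2 * real h * C)"
      using shift_sum[of x C h N] assms by (intro mult_left_mono) auto
    finally show ?case using elim by (simp add: scaleR_diff_right)
  qed
qed

text \<open>The mean of \<open>x\<close> is within \<open>d / 2\<close> of the mean of the window
  averages \<open>y t\<close> over \<open>H\<close> consecutive terms. By Cauchy-Schwarz the squared
  norm of the latter mean is at most the mean of \<open>(nrm (y t))\<^sup>2\<close>, which expands
  into correlations. The off-diagonal ones contribute at most \<open>d\<^sup>2 / 8\<close> and the
  diagonal ones \<open>4 / H\<close>, again at most \<open>d\<^sup>2 / 8\<close>. The bound 2 on the
  terms suits differences of two vectors of norm at most 1.\<close>

lemma van_der_Corput:
  assumes V: "\<And>t. x t \<in> V" and bd: "\<And>t. nrm (x t) \<le> 2" and "d > 0" and H: "32 / d\<^sup>2 \<le> real H" "H > 0"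
    and cor: "\<And>i j. i < H \<Longrightarrow> j < H \<Longrightarrow> i \<noteq> j \<Longrightarrow>
      \<forall>\<^sub>F N in sequentially. (1 / real N) * (\<Sum>t<N. ip (x (t + i)) (x (t + j))) \<le> d\<^sup>2 / 8"
  shows "\<forall>\<^sub>F N in sequentially. nrm ((1 / real N) *\<^sub>R (\<Sum>t<N. x t)) \<le> d"
proof -
  have "\<forall>\<^sub>F N in sequentially. \<forall>i\<in>{..<H}.
      nrm ((1 / real N) *\<^sub>R (\<Sum>t<N. x (t + i)) - (1 / real N) *\<^sub>R (\<Sum>t<N. x t)) \<le> d / 2"
    using shift_mean[of x 2 "d / 2"] V bd \<open>d > 0\<close> by (intro eventually_ball_finite) auto
  moreover have "\<forall>\<^sub>F N in sequentially. \<forall>i\<in>{..<H}. \<forall>j\<in>{..<H}. i \<noteq> j \<longrightarrow>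
      (1 / real N) * (\<Sum>t<N. ip (x (t + i)) (x (t + j))) \<le> d\<^sup>2 / 8"
    using cor by (intro eventually_ball_finite ballI) (auto intro: eventually_mono)
  ultimately show ?thesis using eventually_gt_at_top[of 0]
  proof eventually_elim
    case (elim N)
    define m where "m i = (1 / real N) *\<^sub>R (\<Sum>t<N. x (t + i))" for i
    have mV: "m i \<in> V" for i using V by (auto simp: m_def)
    define y where "y t = (1 / real H) *\<^sub>R (\<Sum>i<H. x (t + i))" for t
    have yV: "y t \<in> V" for t using V by (auto simp: y_def)
    have sw: "(1 / real H) *\<^sub>R (\<Sum>i<H. m i) = (1 / real N) *\<^sub>R (\<Sum>t<N. y t)"
      unfolding m_def y_def scaleR_sum_right
      by (subst sum.swap) (simp add: mult.commute)
    have "(1 / real H) *\<^sub>R (\<Sum>i<H. m 0 - m i) = m 0 - (1 / real H) *\<^sub>R (\<Sum>i<H. m i)"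
      using \<open>H > 0\<close> by (simp add: sum_subtractf scaleR_diff_right sum_constant_scaleR)
    moreover have "nrm ((1 / real H) *\<^sub>R (\<Sum>i<H. m 0 - m i)) \<le> d / 2"
    proof (rule nrm_mean_le)
      fix i assume "i < H"
      then have "nrm (m i - m 0) \<le> d / 2" using elim by (auto simp: m_def)
      then show "nrm (m 0 - m i) \<le> d / 2" by (simp add: nrm_minus_commute mV)
    qed (use mV \<open>d > 0\<close> in auto)
    ultimately have 1: "nrm (m 0 - (1 / real N) *\<^sub>R (\<Sum>t<N. y t)) \<le> d / 2" by (simp add: sw)
    have 2: "nrm ((1 / real N) *\<^sub>R (\<Sum>t<N. y t)) \<le> d / 2"
    proof (rule power2_le_imp_le)
      have "nrm ((1 / real N) *\<^sub>R (\<Sum>t<N. y t)) = (1 / real N) * nrm (\<Sum>t<N. y t)"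
        using yV by (subst nrm_scale) auto
      also have "\<dots> \<le> (1 / real N) * (\<Sum>t<N. nrm (y t))"
        using yV by (intro mult_left_mono nrm_sum) auto
      finally have "(nrm ((1 / real N) *\<^sub>R (\<Sum>t<N. y t)))\<^sup>2 \<le> ((1 / real N) * (\<Sum>t<N. nrm (y t)))\<^sup>2"
        using yV by (intro power_mono) (auto intro!: nrm_nonneg)
      also have "\<dots> \<le> (1 / real N)\<^sup>2 * ((\<Sum>t<N. (nrm (y t))\<^sup>2) * real N)"
        using sum_squared_le_sum_of_squares[of "\<lambda>t. nrm (y t)" "{..<N}"]
        unfolding power_mult_distrib by (intro mult_left_mono) auto
      also have "\<dots> = (1 / real N) * (\<Sum>t<N. (nrm (y t))\<^sup>2)"
        using elim by (simp add: power2_eq_square)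
      also have "(\<lambda>t. (nrm (y t))\<^sup>2) = (\<lambda>t. (1 / real H)\<^sup>2 * (\<Sum>i<H. \<Sum>j<H. ip (x (t + i)) (x (t + j))))"
      proof
        fix t
        have "(\<Sum>i<H. x (t + i)) \<in> V" using V by auto
        then show "(nrm (y t))\<^sup>2 = (1 / real H)\<^sup>2 * (\<Sum>i<H. \<Sum>j<H. ip (x (t + i)) (x (t + j)))"
          unfolding nrm_square[OF yV] unfolding y_def using V
          by (simp add: ip_scale_left ip_scale_right ip_sum_left ip_sum_right power2_eq_square)
            (subst sum.swap, simp flip: sum_divide_distrib)
      qed
      also have "(1 / real N) * (\<Sum>t<N. (1 / real H)\<^sup>2 * (\<Sum>i<H. \<Sum>j<H. ip (x (t + i)) (x (t + j))))
         = (1 / real H)\<^sup>2 * (\<Sum>i<H. \<Sum>j<H. (1 / real N) * (\<Sum>t<N. ip (x (t + i)) (x (t + j))))"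
      proof -
        have "(\<Sum>t<N. \<Sum>i<H. \<Sum>j<H. ip (x (t + i)) (x (t + j)))
            = (\<Sum>i<H. \<Sum>j<H. \<Sum>t<N. ip (x (t + i)) (x (t + j)))"
          by (subst sum.swap) (intro sum.cong refl sum.swap)
        then show ?thesis by (simp flip: sum_distrib_left sum_divide_distrib)
      qed
      also have "\<dots> \<le> (1 / real H)\<^sup>2 * (\<Sum>i<H. \<Sum>j<H. d\<^sup>2 / 8 + (if i = j then 4 else 0))"
      proof (intro mult_left_mono sum_mono)
        fix i j assume ij: "i \<in> {..<H}" "j \<in> {..<H}"
        show "(1 / real N) * (\<Sum>t<N. ip (x (t + i)) (x (t + j))) \<le> d\<^sup>2 / 8 + (if i = j then 4 else 0)"
        proof (cases "i = j")
          case True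
          have "ip (x t) (x t) \<le> 4" for t
            using power_mono[OF bd nrm_nonneg, of t 2] V by (simp add: nrm_square)
          then have "(\<Sum>t<N. ip (x (t + i)) (x (t + j))) \<le> (\<Sum>t<N. 4)"
            unfolding True by (intro sum_mono)
          then have "(1 / real N) * (\<Sum>t<N. ip (x (t + i)) (x (t + j))) \<le> 4"
            using elim by (simp add: field_simps)
          then show ?thesis using True by (simp add: add_increasing)
        qed (use elim ij in auto)
      qed auto
      also have "\<dots> = d\<^sup>2 / 8 + 4 / real H"
      proof -
        have "(\<Sum>i<H. \<Sum>j<H. d\<^sup>2 / 8 + (if i = j then 4 else 0)) = (\<Sum>i<H. real H * (d\<^sup>2 / 8) + 4)"
          by (intro sum.cong) (simp_all add: sum.distrib)
        then show ?thesis using \<open>H > 0\<close> by (simp add: power2_eq_square field_simps)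
      qed
      also have "\<dots> \<le> (d / 2)\<^sup>2"
        using H \<open>d > 0\<close> by (simp add: field_simps)
      finally show "(nrm ((1 / real N) *\<^sub>R (\<Sum>t<N. y t)))\<^sup>2 \<le> (d / 2)\<^sup>2" .
    qed (use \<open>d > 0\<close> in auto)
    have "nrm (m 0) \<le> nrm ((1 / real N) *\<^sub>R (\<Sum>t<N. y t)) + nrm (m 0 - (1 / real N) *\<^sub>R (\<Sum>t<N. y t))"
      using yV mV by (intro nrm_triangle_diff) auto
    then show ?case using 1 2 by (simp add: m_def)
  qed
qed

text \<open>A translation by \<open>h\<close> steps changes only boundary terms of the average,
  which are negligible for large \<open>N\<close>; convex combinations inherit the bound. The
  operator \<open>A\<close> is fixed before \<open>N\<close>.\<close>

lemma avg_near_invariant: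
  assumes "A \<in> Av (range (\<lambda>n. n *s c))" "u \<in> V" "e > 0"
  shows "\<forall>\<^sub>F N in sequentially. nrm (A (avg (\<lambda>t. int t *s c) N u) - avg (\<lambda>t. int t *s c) N u) \<le> e"
  using assms(1)
proof (induction rule: Av.induct)
  case (U w)
  have pos: "\<forall>\<^sub>F N in sequentially. nrm (U (int h *s c) (avg (\<lambda>t. int t *s c) N u) - avg (\<lambda>t. int t *s c) N u) \<le> e" for h
  proof -
    have "\<forall>\<^sub>F N in sequentially. nrm ((1 / real N) *\<^sub>R (\<Sum>t<N. U (int (t + h) *s c) u)
         - (1 / real N) *\<^sub>R (\<Sum>t<N. U (int t *s c) u)) \<le> e"
      using assms by (intro shift_mean[where C = "nrm u"]) (auto simp: nrm_U)
    moreover have "U (int (t + h) *s c) u = U (int h *s c) (U (int t *s c) u)" for t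
      by (simp add: vector_sadd_rdistrib add.commute flip: U_add)
    ultimately show ?thesis by (simp add: avg_def U_lin)
  qed
  obtain n where w: "w = n *s c" using U by auto
  show ?case
  proof (cases "n \<ge> 0")
    case True
    then show ?thesis using pos[of "nat n"] w by simp
  next
    case False
    \<comment> \<open>Negative multiples reduce to positive ones, because \<open>U (- w)\<close> is
      an isometry inverse to \<open>U w\<close>.\<close>
    have "nrm (U w z - z) = nrm (U (- w) z - z)" if "z \<in> V" for z
    proof -
      have "nrm (U w z - z) = nrm (U (- w) (U w z - z))" using that by (simp add: nrm_U)
      also have "\<dots> = nrm (z - U (- w) z)"
        using that by (simp add: U_lin U_zero flip: U_add)
      finally show ?thesis using that by (simp add: nrm_minus_commute)
    qed
    moreover have "- w = int (nat (- n)) *s c" using False w by (simp add: vec_eq_iff)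
    ultimately show ?thesis using pos[of "nat (- n)"] assms(2) by simp
  qed
next
  case (cvx A B a)
  from cvx.IH show ?case
  proof eventually_elim
    case (elim N)
    let ?z = "avg (\<lambda>t. int t *s c) N u"
    have "a *\<^sub>R A ?z + (1 - a) *\<^sub>R B ?z - ?z = a *\<^sub>R (A ?z - ?z) + (1 - a) *\<^sub>R (B ?z - ?z)"
      by (simp add: algebra_simps)
    then show ?case using cvx.hyps elim assms(2) by (auto intro!: nrm_cvx)
  qed
qed

section \<open>Vanishing of polynomial averages\<close>

text \<open>A quantitative form of orthogonality of \<open>u\<close> to the vectors fixed by some
  nonzero multiple of \<open>w\<close>: by the mean ergodic theorem, small convex combinations mean
  a small projection to the fixed vectors.\<close>

definition aperiodic :: "int ^ 'd \<Rightarrow> 'v \<Rightarrow> real \<Rightarrow> bool" where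
  "aperiodic w u e \<longleftrightarrow> (\<forall>q. q \<noteq> 0 \<longrightarrow> (\<exists>A \<in> Av (range (\<lambda>n. n *s (q *s w))). nrm (A u) \<le> e))"

text \<open>Induction on the degree by van der Corput differencing. The threshold \<open>e\<close>
  depends on \<open>d\<close> and \<open>D\<close> only, so that it can be fixed before the vector
  \<open>u\<close> is constructed.\<close>

lemma Weyl_vanish:
  assumes "d > 0"
  shows "\<exists>e>0. \<forall>u c w p. u \<in> V \<longrightarrow> nrm u \<le> 2 \<longrightarrow> p \<noteq> 0 \<longrightarrow> c (Suc D) = p *s w \<longrightarrow> aperiodic w u e \<longrightarrow>
    (\<forall>\<^sub>F N in sequentially. nrm (avg (\<lambda>t. vpoly c (Suc D) (int t)) N u) \<le> d)"
  using assms
proof (induction D arbitrary: d)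
  case 0
  show ?case
  proof (intro exI[of _ "d / 2"] conjI allI impI)
    fix u c w p
    assume u: "u \<in> V" "nrm u \<le> 2" and p: "(p::int) \<noteq> 0" "c (Suc 0) = p *s w" and ap: "aperiodic w u (d / 2)"
    \<comment> \<open>Aperiodicity is applied with the multiple \<open>p\<close> itself, since
      \<open>c (Suc 0)\<close> is \<open>p *s w\<close>.\<close>
    then obtain A where A: "A \<in> Av (range (\<lambda>n. n *s c (Suc 0)))" "nrm (A u) \<le> d / 2"
      unfolding aperiodic_def by metis
    have "\<forall>\<^sub>F N in sequentially. nrm (A (avg (\<lambda>t. int t *s c (Suc 0)) N u)
        - avg (\<lambda>t. int t *s c (Suc 0)) N u) \<le> d / 2"
      using A u 0 by (intro avg_near_invariant) auto
    then show "\<forall>\<^sub>F N in sequentially. nrm (avg (\<lambda>t. vpoly c (Suc 0) (int t)) N u) \<le> d"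
      using eventually_gt_at_top[of 0]
    proof eventually_elim
      case (elim N)
      let ?a = "avg (\<lambda>t. int t *s c (Suc 0)) N u"
      have "avg (\<lambda>t. vpoly c (Suc 0) (int t)) N u = U (c 0) ?a"
        by (simp add: avg_def vpoly_def U_lin U_add)
      then have "nrm (avg (\<lambda>t. vpoly c (Suc 0) (int t)) N u) = nrm ?a"
        using u by (simp add: nrm_U)
      also have "\<dots> \<le> nrm (A ?a) + nrm (?a - A ?a)" using A u by (intro nrm_triangle_diff) auto
      finally have "nrm (avg (\<lambda>t. vpoly c (Suc 0) (int t)) N u) \<le> nrm (A ?a) + nrm (?a - A ?a)" .
      \<comment> \<open>Commuting \<open>A\<close> with the average transfers the smallness of
        \<open>A u\<close> to \<open>A ?a\<close>, and \<open>?a\<close> is close to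
        \<open>A ?a\<close>.\<close>
      moreover have "A ?a = avg (\<lambda>t. int t *s c (Suc 0)) N (A u)"
        using Av_commute[OF A(1) avg_in_Av] elim by auto
      then have "nrm (A ?a) \<le> nrm (A u)" using A u elim avg_nrm by auto
      moreover have "nrm (?a - A ?a) \<le> d / 2" using elim A u by (subst nrm_minus_commute) auto
      ultimately show ?case using A by simp
    qed
  qed (use 0 in auto)
next
  case (Suc D)
  \<comment> \<open>Multiplied by the bound 2 on \<open>nrm u\<close>, this gives the correlation
    bound \<open>d\<^sup>2 / 8\<close> of \<open>van_der_Corput\<close>.\<close>
  have "d\<^sup>2 / 16 > 0" using Suc.prems by simp
  from Suc.IH[OF this] obtain e where "e > 0"
    and e: "\<And>u c w p. \<lbrakk>u \<in> V; nrm u \<le> 2; p \<noteq> 0; c (Suc D) = p *s w; aperiodic w u e\<rbrakk> \<Longrightarrow>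
      \<forall>\<^sub>F N in sequentially. nrm (avg (\<lambda>t. vpoly c (Suc D) (int t)) N u) \<le> d\<^sup>2 / 16"
    by blast
  show ?case
  proof (intro exI[of _ e] conjI allI impI)
    fix u c w p
    assume u: "u \<in> V" "nrm u \<le> 2" and p: "(p::int) \<noteq> 0" "c (Suc (Suc D)) = p *s w" and ap: "aperiodic w u e"
    define H where "H = Suc (nat \<lceil>32 / d\<^sup>2\<rceil>)"
    have H: "32 / d\<^sup>2 \<le> real H" "H > 0" unfolding H_def by linarith+
    show "\<forall>\<^sub>F N in sequentially. nrm (avg (\<lambda>t. vpoly c (Suc (Suc D)) (int t)) N u) \<le> d"
      unfolding avg_def
    proof (rule van_der_Corput[OF _ _ \<open>d > 0\<close> H])
      fix i j :: nat assume ij: "i \<noteq> j"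
      obtain c' where c': "\<And>t. vpoly c (Suc (Suc D)) (t + int i) - vpoly c (Suc (Suc D)) (t + int j) = vpoly c' (Suc D) t"
        "c' (Suc D) = (int (Suc (Suc D)) * (int i - int j)) *s c (Suc (Suc D))"
        using vpoly_diff[of c "Suc D" "int i" "int j"] by blast
      \<comment> \<open>Differencing keeps the leading coefficient a nonzero multiple of the same
        \<open>w\<close>. The factor changes at every stage, which is why \<open>aperiodic\<close>
        quantifies over all multiples.\<close>
      have c'2: "c' (Suc D) = (int (Suc (Suc D)) * (int i - int j) * p) *s w"
        by (simp add: c' p)
      have "\<forall>\<^sub>F N in sequentially. nrm (avg (\<lambda>t. vpoly c' (Suc D) (int t)) N u) \<le> d\<^sup>2 / 16"
        by (rule e[where c = c', OF u _ c'2 ap]) (use p ij in simp)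
      then show "\<forall>\<^sub>F N in sequentially. (1 / real N) * (\<Sum>t<N. ip (U (vpoly c (Suc (Suc D)) (int (t + i))) u)
         (U (vpoly c (Suc (Suc D)) (int (t + j))) u)) \<le> d\<^sup>2 / 8"
      proof eventually_elim
        case (elim N)
        have "ip (U (vpoly c (Suc (Suc D)) (int (t + i))) u) (U (vpoly c (Suc (Suc D)) (int (t + j))) u)
          = ip (U (vpoly c' (Suc D) (int t)) u) u" for t
        proof -
          have "vpoly c (Suc (Suc D)) (int (t + i)) = vpoly c (Suc (Suc D)) (int (t + j)) + vpoly c' (Suc D) (int t)"
            using c'(1)[of "int t"] by (simp add: algebra_simps)
          then show ?thesis using u by (simp add: U_add ip_U)
        qed
        then have "(1 / real N) * (\<Sum>t<N. ip (U (vpoly c (Suc (Suc D)) (int (t + i))) u)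
             (U (vpoly c (Suc (Suc D)) (int (t + j))) u)) = ip (avg (\<lambda>t. vpoly c' (Suc D) (int t)) N u) u"
          using u by (simp add: avg_def ip_scale_left ip_sum_left V_sum)
        also have "\<dots> \<le> nrm (avg (\<lambda>t. vpoly c' (Suc D) (int t)) N u) * nrm u"
          using Cauchy_Schwarz[of "avg (\<lambda>t. vpoly c' (Suc D) (int t)) N u" u] u by auto
        also have "\<dots> \<le> (d\<^sup>2 / 16) * 2" using u elim by (intro mult_mono nrm_nonneg) auto
        finally show ?case by simp
      qed
    qed (use u in \<open>auto simp: nrm_U\<close>)
  qed (use \<open>e > 0\<close> in auto)
qed

section \<open>Near minimisers of the norm\<close>

text \<open>For a subgroup \<open>L\<close> this is the norm of the projection of \<open>f\<close>
  to the \<open>L\<close>-invariant vectors in the Hilbert completion.\<close>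

definition minnrm :: "(int ^ 'd) set \<Rightarrow> 'v \<Rightarrow> real" where
  "minnrm L f = (INF A\<in>Av L. nrm (A f))"

lemma minnrm_bdd: "f \<in> V \<Longrightarrow> bdd_below ((\<lambda>A. nrm (A f)) ` Av L)"
  by (rule bdd_belowI2[of _ 0]) (auto intro: nrm_nonneg)

lemma minnrm_le: "f \<in> V \<Longrightarrow> A \<in> Av L \<Longrightarrow> minnrm L f \<le> nrm (A f)"
  unfolding minnrm_def by (rule cINF_lower[OF minnrm_bdd])

lemma Av_nonempty: "L \<noteq> {} \<Longrightarrow> Av L \<noteq> {}"
  using Av.U by blast

lemma minnrm_nonneg: "f \<in> V \<Longrightarrow> L \<noteq> {} \<Longrightarrow> 0 \<le> minnrm L f"
  unfolding minnrm_def by (rule cINF_greatest) (auto simp: Av_nonempty intro: nrm_nonneg)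

lemma minnrm_le_nrm: "f \<in> V \<Longrightarrow> L \<noteq> {} \<Longrightarrow> minnrm L f \<le> nrm f"
  using Av_nonempty[of L] minnrm_le Av_nrm by (metis equals0I order_trans)

lemma minnrm_approx:
  assumes "f \<in> V" "L \<noteq> {}" "minnrm L f < r"
  obtains A where "A \<in> Av L" "nrm (A f) \<le> r"
  using assms cINF_less_iff[OF Av_nonempty[OF assms(2)] minnrm_bdd[OF assms(1)], of r]
  unfolding minnrm_def by force

text \<open>The midpoint of \<open>A f\<close> and \<open>B f\<close> also comes from
  \<open>Av L\<close>, so its norm is at least the infimum \<open>r\<close>. The parallelogram law
  then bounds the squared distance by \<open>4 * (r + e)\<^sup>2 - 4 * r\<^sup>2\<close>, which is
  at most \<open>12 * e\<close> because \<open>r\<close> and \<open>e\<close> are at most 1.\<close>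

lemma near_min_close:
  assumes f: "f \<in> V" "nrm f \<le> 1" and e: "0 \<le> e" "e \<le> 1"
    and A: "A \<in> Av L" "nrm (A f) \<le> minnrm L f + e"
    and B: "B \<in> Av L" "nrm (B f) \<le> minnrm L f + e"
    and s: "12 * e \<le> s\<^sup>2" "0 \<le> s"
  shows "nrm (A f - B f) \<le> s"
proof (rule power2_le_imp_le)
  define r where "r = minnrm L f"
  have "L \<noteq> {}" using A(1) by (induction rule: Av.induct) auto
  then have r: "0 \<le> r" "r \<le> 1" using minnrm_nonneg[of f L] minnrm_le_nrm[of f L] f by (auto simp: r_def)
  have "(\<lambda>x. (1/2) *\<^sub>R A x + (1 - 1/2) *\<^sub>R B x) \<in> Av L" using A B by (intro Av.cvx) auto
  from minnrm_le[OF f(1) this] have "r\<^sup>2 \<le> (nrm ((1/2) *\<^sub>R A f + (1/2) *\<^sub>R B f))\<^sup>2"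
    using r by (intro power_mono) (auto simp: r_def)
  moreover have "(nrm (A f))\<^sup>2 \<le> (r + e)\<^sup>2" "(nrm (B f))\<^sup>2 \<le> (r + e)\<^sup>2"
    using A B f by (auto intro!: power_mono nrm_nonneg simp: r_def)
  ultimately have "(nrm (A f - B f))\<^sup>2 \<le> 4 * (r + e)\<^sup>2 - 4 * r\<^sup>2"
    using A B f by (subst parallelogram) auto
  also have "\<dots> = 8 * (r * e) + 4 * (e * e)" by (simp add: power2_eq_square algebra_simps)
  also have "\<dots> \<le> 8 * e + 4 * e"
    using r e mult_right_mono[of r 1 e] mult_right_mono[of e 1 e] by (intro add_mono mult_left_mono) auto
  finally show "(nrm (A f - B f))\<^sup>2 \<le> s\<^sup>2" using s by simp
qed (use s in auto)

text \<open>Since \<open>L\<close> is closed under addition, following \<open>A\<close> by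
  \<open>U w\<close> stays in \<open>Av L\<close>, and the norm does not change; so
  \<open>near_min_close\<close> compares two near minimisers.\<close>

lemma near_min_invariant:
  assumes f: "f \<in> V" "nrm f \<le> 1" and e: "0 \<le> e" "e \<le> 1"
    and A: "A \<in> Av L" "nrm (A f) \<le> minnrm L f + e"
    and s: "12 * e \<le> s\<^sup>2" "0 \<le> s"
    and L: "\<And>u w. u \<in> L \<Longrightarrow> w \<in> L \<Longrightarrow> u + w \<in> L" and w: "w \<in> L"
  shows "nrm (U w (A f) - A f) \<le> s"
proof -
  have "(\<lambda>x. U w (A x)) \<in> Av L"
    by (rule Av_comp[of "U w" "{w}" A L]) (use A L w in \<open>auto intro: Av.U\<close>)
  then show ?thesis
    using A f by (intro near_min_close[where A = "\<lambda>x. U w (A x)", OF f e _ _ A s]) (auto simp: nrm_U)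
qed

section \<open>Polynomial averages and nearly invariant vectors\<close>

text \<open>Induction on the degree. With \<open>w\<close> the top coefficient, \<open>f\<close> is
  split into a part \<open>g\<close> nearly invariant under multiples of some \<open>q *s w\<close>
  and a remainder aperiodic along \<open>w\<close>. The remainder averages to nearly nothing by
  \<open>Weyl_vanish\<close>. On \<open>g\<close> the top term is invisible at times divisible by
  \<open>q\<close>, so a curve of lower degree remains.\<close>

lemma rational_reduction:
  assumes "d > 0" "f \<in> V" "nrm f \<le> 1"
  shows "\<exists>A\<in>Av UNIV. \<exists>Q>0. \<exists>K>0.
    (\<forall>\<^sub>F N in sequentially. nrm (avg (\<lambda>t. vpoly c D (int Q * int t)) N f) \<le> nrm (A f) + d) \<and>
    (\<forall>j\<in>{1..D}. \<forall>n. nrm (U ((int K * n) *s c j) (A f) - A f) \<le> d)"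
  using assms
proof (induction D arbitrary: c f d)
  case 0
  have "nrm (avg (\<lambda>t. vpoly c 0 (int 1 * int t)) N f) \<le> nrm (U 0 f) + d" if "N > 0" for N
    using avg_nrm[OF \<open>f \<in> V\<close> that, of "\<lambda>t. vpoly c 0 (int t)"] 0 by (simp add: nrm_U)
  then have "\<forall>\<^sub>F N in sequentially. nrm (avg (\<lambda>t. vpoly c 0 (int 1 * int t)) N f) \<le> nrm (U 0 f) + d"
    by (meson eventually_gt_at_top eventually_mono)
  then show ?case by (intro bexI[of _ "U 0"] exI[of _ 1] conjI) (auto intro: Av.U)
next
  case (Suc D)
  note fV = \<open>f \<in> V\<close> and f1 = \<open>nrm f \<le> 1\<close>
  define w where "w = c (Suc D)"
  obtain e0 where "e0 > 0" and e0: "\<And>u c w p. \<lbrakk>u \<in> V; nrm u \<le> 2; p \<noteq> 0; c (Suc D) = p *s w; aperiodic w u e0\<rbrakk> \<Longrightarrow>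
      \<forall>\<^sub>F N in sequentially. nrm (avg (\<lambda>t. vpoly c (Suc D) (int t)) N u) \<le> d / 4"
    using Weyl_vanish[of "d / 4" D] \<open>d > 0\<close> by auto
  \<comment> \<open>Two errors of size \<open>s\<close> fit into the aperiodicity threshold
    \<open>e0\<close> and into \<open>d / 4\<close>.\<close>
  define s where "s = min (min e0 (d / 4)) 1 / 2"
  have s: "0 < s" "2 * s \<le> e0" "2 * s \<le> d / 4" "s \<le> 1" using \<open>e0 > 0\<close> \<open>d > 0\<close> by (auto simp: s_def)
  \<comment> \<open>Near minimisers with excess up to \<open>2 * e\<close> are within
    \<open>s\<close> of each other by \<open>near_min_close\<close>.\<close>
  define e where "e = s\<^sup>2 / 24"
  have "s\<^sup>2 \<le> 1" using s by (simp add: power_le_one)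
  then have e: "0 < e" "2 * e \<le> 1" "12 * (2 * e) \<le> s\<^sup>2" using s by (auto simp: e_def)
  define L where "L q = range (\<lambda>n. n *s (q *s w))" for q
  have L_ne: "L q \<noteq> {}" for q by (simp add: L_def)
  have L_add: "u + v \<in> L q" if "u \<in> L q" "v \<in> L q" for u v q
  proof -
    from that obtain m n where "u = m *s (q *s w)" "v = n *s (q *s w)" unfolding L_def by blast
    then have "u + v = (m + n) *s (q *s w)" by (simp only: vector_sadd_rdistrib)
    then show ?thesis by (auto simp: L_def)
  qed
  have L_mono: "L (q * q') \<subseteq> L q" for q q'
  proof
    fix x assume "x \<in> L (q * q')"
    then obtain n where "x = n *s ((q * q') *s w)" by (auto simp: L_def)
    then have "x = (n * q') *s (q *s w)" by (simp add: mult.left_commute mult.commute)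
    then show "x \<in> L q" by (auto simp: L_def)
  qed
  \<comment> \<open>The shifted index keeps the modulus positive. Passing to a multiple of the
    modulus shrinks the lattice and so cannot decrease the infimum; a nearly maximal value can grow
    by at most \<open>e\<close>.\<close>
  define rho where "rho n = minnrm (L (int (Suc n))) f" for n
  have bdd: "bdd_above (range rho)"
    using minnrm_le_nrm[OF fV L_ne] by (intro bdd_aboveI2[of _ _ "nrm f"]) (simp add: rho_def)
  obtain n0 where n0: "(SUP n. rho n) - e < rho n0"
    using less_cSUP_iff[of UNIV rho "(SUP n. rho n) - e"] bdd e by auto
  have rho_n0: "rho n < rho n0 + e" for n using cSUP_upper[OF _ bdd, of n] n0 by simp
  define q where "q = Suc n0"
  obtain B where B: "B \<in> Av (L (int q))" "nrm (B f) \<le> rho n0 + e"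
    using minnrm_approx[OF fV L_ne, of "int q" "rho n0 + e"] e by (auto simp: rho_def q_def)
  define g where "g = B f"
  have gV: "g \<in> V" and g1: "nrm g \<le> 1"
    using B fV f1 Av_nrm[OF B(1) fV] by (auto simp: g_def)
  have g_inv: "nrm (U b g - g) \<le> s" if "b \<in> L (int q)" for b
    unfolding g_def using e s B that L_add
    by (intro near_min_invariant[OF fV f1, of "2 * e" B "L (int q)" s b])
      (auto simp: rho_def q_def)
  \<comment> \<open>For given \<open>p\<close>, a near minimiser \<open>A\<close> over the lattice
    of modulus \<open>q * |p|\<close> is still nearly minimal over \<open>L q\<close>. Thus
    \<open>A f\<close> is close to \<open>g\<close>, and \<open>A g\<close> is close to
    \<open>g\<close> by near invariance, so \<open>A (f - g)\<close> is small.\<close>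
  have ap: "aperiodic w (f - g) e0"
    unfolding aperiodic_def
  proof (intro allI impI)
    fix p :: int assume "p \<noteq> 0"
    then have "int q * \<bar>p\<bar> > 0" by (simp add: q_def)
    then have n1: "int q * \<bar>p\<bar> = int (Suc (nat (int q * \<bar>p\<bar>) - 1))" by simp
    have "minnrm (L (int q * \<bar>p\<bar>)) f < rho n0 + 2 * e"
      using rho_n0[of "nat (int q * \<bar>p\<bar>) - 1"] n1 e unfolding rho_def by simp
    then obtain A where A: "A \<in> Av (L (int q * \<bar>p\<bar>))" "nrm (A f) \<le> rho n0 + 2 * e"
      using minnrm_approx[OF fV L_ne] by metis
    have Aq: "A \<in> Av (L (int q))" using Av_mono[OF A(1) L_mono] .
    \<comment> \<open>The same lattice therefore also consists of multiples of
      \<open>p *s w\<close>, as aperiodicity demands.\<close>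
    have "int q * \<bar>p\<bar> = p * (int q * sgn p)" by (simp add: abs_sgn mult.left_commute)
    then have Ap: "A \<in> Av (range (\<lambda>n. n *s (p *s w)))" using Av_mono[OF A(1)] L_mono unfolding L_def by metis
    have "nrm (A f - B f) \<le> s"
      using e s A B Aq by (intro near_min_close[OF fV f1, of "2 * e" A "L (int q)"]) (auto simp: rho_def q_def)
    moreover have "nrm (A g - g) \<le> s"
      by (rule Av_near_invariant[OF Aq gV g_inv])
    moreover have "nrm (A (f - g)) \<le> nrm (A f - g) + nrm (g - A g)"
      using A fV gV unfolding Av_lin(2)[OF A(1)] by (intro nrm_triangle_diff2) auto
    moreover have "nrm (g - A g) = nrm (A g - g)" using Ap gV by (intro nrm_minus_commute) auto
    ultimately have "nrm (A (f - g)) \<le> e0" using s by (simp add: g_def)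
    then show "\<exists>A\<in>Av (range (\<lambda>n. n *s (p *s w))). nrm (A (f - g)) \<le> e0" using Ap by blast
  qed
  \<comment> \<open>These are the coefficients of the curve run at times divisible by
    \<open>q\<close>. There the top term lies in \<open>L q\<close> and barely moves
    \<open>g\<close>, so the induction hypothesis is applied to the lower terms only.\<close>
  define c' where "c' l = int q ^ l *s c l" for l
  obtain A1 Q1 K1 where A1: "A1 \<in> Av UNIV" and Q1: "Q1 > 0" and K1: "K1 > 0"
    and ev1: "\<forall>\<^sub>F N in sequentially. nrm (avg (\<lambda>t. vpoly c' D (int Q1 * int t)) N g) \<le> nrm (A1 g) + d / 4"
    and inv1: "\<And>j n. j \<in> {1..D} \<Longrightarrow> nrm (U ((int K1 * n) *s c' j) (A1 g) - A1 g) \<le> d / 4"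
    using Suc.IH[of "d / 4" g c'] \<open>d > 0\<close> gV g1 by auto
  define Q where "Q = q * Q1"
  \<comment> \<open>One factor \<open>q\<close> puts multiples of the top coefficient into
    \<open>L q\<close>; for \<open>j \<le> D\<close> a factor \<open>q ^ j\<close> turns
    \<open>c j\<close> into \<open>c' j\<close>, and \<open>K1\<close> remains.\<close>
  define K where "K = K1 * q ^ Suc D"
  have Q: "Q > 0" and K: "K > 0" using Q1 K1 by (auto simp: Q_def K_def q_def)
  have vp: "vpoly c (Suc D) (int Q * int t) = vpoly (\<lambda>l. int Q ^ l *s c l) (Suc D) (int t)" for t
    by (simp add: vpoly_def power_mult_distrib mult.commute)
  have ev2: "\<forall>\<^sub>F N in sequentially. nrm (avg (\<lambda>t. vpoly c (Suc D) (int Q * int t)) N (f - g)) \<le> d / 4"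
    unfolding vp
  proof (rule e0[OF _ _ _ _ ap])
    \<comment> \<open>At times \<open>Q * t\<close> the top coefficient is this nonzero multiple of
      \<open>w\<close>.\<close>
    show "int Q ^ Suc D \<noteq> 0" using Q by simp
    show "nrm (f - g) \<le> 2"
      using nrm_triangle_diff2[OF fV _ gV, of 0] f1 g1 nrm_minus_commute[of 0 g] gV by simp
  qed (use fV gV in \<open>auto simp: w_def\<close>)
  have "\<forall>\<^sub>F N in sequentially. nrm (avg (\<lambda>t. vpoly c (Suc D) (int Q * int t)) N f) \<le> nrm (A1 (B f)) + d"
    using ev1 ev2
  proof eventually_elim
    case (elim N)
    let ?P = "\<lambda>t. vpoly c (Suc D) (int Q * int t)" and ?R = "\<lambda>t. vpoly c' D (int Q1 * int t)"
    have "nrm (avg ?P N g - avg ?R N g) \<le> s"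
    proof -
      have eq: "avg ?P N g - avg ?R N g = (1 / real N) *\<^sub>R (\<Sum>t<N. U (?P t) g - U (?R t) g)"
        by (simp add: avg_def sum_subtractf scaleR_diff_right)
      have "nrm (U (?P t) g - U (?R t) g) \<le> s" for t
      proof -
        define b where "b = (int Q * int t) ^ Suc D *s w"
        have "?P t = vpoly c D (int Q * int t) + b"
          by (simp add: vpoly_Suc b_def w_def)
        also have "vpoly c D (int Q * int t) = ?R t"
          by (simp add: vpoly_def c'_def Q_def power_mult_distrib mult_ac)
        finally have P: "?P t = ?R t + b" .
        have "b = (int q ^ D * (int Q1 * int t) ^ Suc D) *s (int q *s w)"
          by (simp add: b_def Q_def power_mult_distrib mult_ac)
        then have "b \<in> L (int q)" by (auto simp: L_def)
        then have "nrm (U b g - g) \<le> s" by (rule g_inv)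
        then show ?thesis unfolding P U_add using gV by (simp add: nrm_U flip: U_lin)
      qed
      then show ?thesis unfolding eq using gV s by (intro nrm_mean_le) auto
    qed
    moreover have "nrm (avg ?P N g) \<le> nrm (avg ?R N g) + nrm (avg ?P N g - avg ?R N g)"
      using gV by (intro nrm_triangle_diff) auto
    moreover have "nrm (avg ?P N f) \<le> nrm (avg ?P N g) + nrm (avg ?P N f - avg ?P N g)"
      using fV gV by (intro nrm_triangle_diff) auto
    ultimately show ?case using elim s \<open>d > 0\<close> by (simp add: avg_lin g_def)
  qed
  moreover have "nrm (U ((int K * n) *s c j) (A1 (B f)) - A1 (B f)) \<le> d" if j: "j \<in> {1..Suc D}" for j n
  proof (cases "j = Suc D")
    case True
    have "(int K * n) *s c j = (int K1 * int q ^ D * n) *s (int q *s w)"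
      by (simp add: K_def True w_def mult_ac)
    then have "(int K * n) *s c j \<in> L (int q)" by (auto simp: L_def)
    then have "nrm (U ((int K * n) *s c j) g - g) \<le> s" by (rule g_inv)
    moreover have "nrm (A1 (U ((int K * n) *s c j) g - g)) \<le> nrm (U ((int K * n) *s c j) g - g)"
      using gV by (intro Av_nrm[OF A1]) auto
    ultimately show ?thesis
      using s \<open>d > 0\<close> by (simp add: Av_lin[OF A1] U_Av_commute[OF A1] g_def)
  next
    case False
    then have "j \<in> {1..D}" using j by auto
    have "int q ^ Suc D = int q ^ j * int q ^ (Suc D - j)" using j by (simp flip: power_add)
    then have "int K * n = int K1 * (n * int q ^ (Suc D - j)) * int q ^ j"
      unfolding K_def of_nat_mult of_nat_power by (simp only: mult_ac)
    then have "(int K * n) *s c j = (int K1 * (n * int q ^ (Suc D - j))) *s c' j"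
      by (simp only: c'_def vector_smult_assoc)
    then show ?thesis
      using inv1[OF \<open>j \<in> {1..D}\<close>, of "n * int q ^ (Suc D - j)"] \<open>d > 0\<close> by (simp add: g_def)
  qed
  moreover have "(\<lambda>x. A1 (B x)) \<in> Av UNIV" using A1 B by (auto intro: Av_comp)
  ultimately show ?case using Q K by (intro bexI[of _ "\<lambda>x. A1 (B x)"] exI[of _ Q] exI[of _ K] conjI) auto
qed

lemma near_invariant_sum:
  assumes "finite J" "\<And>j. j \<in> J \<Longrightarrow> nrm (U (b j) x - x) \<le> d" "x \<in> V"
  shows "nrm (U (sum b J) x - x) \<le> real (card J) * d"
  using assms
proof (induction J rule: finite_induct)
  case empty
  then show ?case by (simp add: U_zero nrm_zero)
next
  case (insert j J)
  have "nrm (U (b j + sum b J) x - x) \<le> nrm (U (b j + sum b J) x - U (b j) x) + nrm (U (b j) x - x)"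
    using insert by (intro nrm_triangle_diff2) auto
  also have "nrm (U (b j + sum b J) x - U (b j) x) = nrm (U (sum b J) x - x)"
    unfolding U_add using insert.prems by (simp add: nrm_U flip: U_lin)
  finally have "nrm (U (b j + sum b J) x - x) \<le> nrm (U (sum b J) x - x) + nrm (U (b j) x - x)" .
  moreover have "nrm (U (sum b J) x - x) \<le> real (card J) * d" "nrm (U (b j) x - x) \<le> d"
    using insert by auto
  ultimately show ?case using insert.hyps by (simp add: algebra_simps)
qed

text \<open>One \<open>k\<close> and one \<open>B\<close> serve all curves, because \<open>k\<close>
  nearly maximises the minimal norm over all lattices. The spanning hypothesis makes the vector from
  \<open>rational_reduction\<close> nearly invariant under a whole sublattice. This bounds its norm
  by nearly the minimal norm there, hence by nearly the one for \<open>k\<close>. Averages along the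
  curve are thus nearly minimal, and so close to \<open>B f\<close>.\<close>

theorem polynomial_averages:
  assumes fV: "f \<in> V" and f1: "nrm f \<le> 1" and "e > 0"
  obtains k B where "k > 0" "B \<in> Av (mult_lattice k)"
    "\<And>w. w \<in> mult_lattice k \<Longrightarrow> nrm (U w (B f) - B f) \<le> e"
    "\<And>c D K. \<lbrakk>\<And>t. vpoly c D t \<in> mult_lattice k; K > 0;
        \<And>w. w \<in> mult_lattice K \<Longrightarrow> \<exists>n. w = (\<Sum>j\<in>{1..D}. n j *s c j)\<rbrakk> \<Longrightarrow>
      \<exists>A\<in>Av (range (\<lambda>t. vpoly c D (int t))). nrm (A f - B f) \<le> e"
proof -
  \<comment> \<open>Every excess over the minimal norm below stays within \<open>3 * h\<close>,
    which \<open>near_min_close\<close> turns into distance \<open>e\<close>.\<close>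
  define h where "h = min (1 / 3) (e\<^sup>2 / 36)"
  have h: "0 < h" "3 * h \<le> 1" "12 * (3 * h) \<le> e\<^sup>2" using \<open>e > 0\<close> by (auto simp: h_def)
  define rho where "rho n = minnrm (mult_lattice (Suc n)) f" for n
  have bdd: "bdd_above (range rho)"
    using minnrm_le_nrm[OF fV mult_lattice_ne] by (intro bdd_aboveI2[of _ _ "nrm f"]) (simp add: rho_def)
  obtain n0 where n0: "(SUP n. rho n) - h < rho n0"
    using less_cSUP_iff[of UNIV rho "(SUP n. rho n) - h"] bdd h by auto
  have rho_n0: "rho n < rho n0 + h" for n using cSUP_upper[OF _ bdd, of n] n0 by simp
  define k where "k = Suc n0"
  obtain B where B: "B \<in> Av (mult_lattice k)" "nrm (B f) \<le> rho n0 + h"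
    using minnrm_approx[OF fV mult_lattice_ne, of k "rho n0 + h"] h by (auto simp: rho_def k_def)
  have B3: "nrm (B f) \<le> minnrm (mult_lattice k) f + 3 * h" using B h by (simp add: rho_def k_def)
  show thesis
  proof
    show "k > 0" by (simp add: k_def)
    show "B \<in> Av (mult_lattice k)" by fact
    show "nrm (U w (B f) - B f) \<le> e" if "w \<in> mult_lattice k" for w
      using h B B3 that \<open>e > 0\<close> mult_lattice_add
      by (intro near_min_invariant[OF fV f1, of "3 * h" B "mult_lattice k"]) auto
    fix c :: "nat \<Rightarrow> int ^ 'd" and D K
    assume c: "\<And>t. vpoly c D t \<in> mult_lattice k" and "K > 0"
      and span: "\<And>w. w \<in> mult_lattice K \<Longrightarrow> \<exists>n. w = (\<Sum>j\<in>{1..D}. n j *s c j)"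
    \<comment> \<open>The \<open>D\<close> invariance errors, one for each nonconstant coefficient,
      and the error of the average add up to \<open>h\<close>.\<close>
    define d where "d = h / real (Suc D)"
    have "real (Suc D) * d = h" by (simp add: d_def)
    then have "real D * d + d = h" by (metis add.commute distrib_right mult_1 of_nat_Suc)
    then have d: "d > 0" "real D * d + d = h" using h by (auto simp: d_def)
    obtain A Q K1 where A: "A \<in> Av UNIV" and K1: "K1 > 0"
      and ev: "\<forall>\<^sub>F N in sequentially. nrm (avg (\<lambda>t. vpoly c D (int Q * int t)) N f) \<le> nrm (A f) + d"
      and inv: "\<And>j n. j \<in> {1..D} \<Longrightarrow> nrm (U ((int K1 * n) *s c j) (A f) - A f) \<le> d"
      using rational_reduction[OF d(1) fV f1, of c D] by auto
    \<comment> \<open>A vector divisible by \<open>K1 * K\<close> is an integer combination of the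
      \<open>K1\<close>-fold coefficients, under each of which \<open>A f\<close> is nearly
      invariant.\<close>
    define k' where "k' = k * (K1 * K)"
    have k': "k' = Suc (k' - 1)" using \<open>k > 0\<close> \<open>K > 0\<close> K1 by (simp add: k'_def)
    have "minnrm (mult_lattice k') f < rho n0 + h" using rho_n0[of "k' - 1"] k' by (simp add: rho_def)
    then obtain B' where B': "B' \<in> Av (mult_lattice k')" "nrm (B' f) \<le> rho n0 + h"
      using minnrm_approx[OF fV mult_lattice_ne] by metis
    have "nrm (U w (A f) - A f) \<le> real D * d" if "w \<in> mult_lattice k'" for w
    proof -
      have "w \<in> mult_lattice (K1 * K)"
        using that unfolding mult_lattice_def k'_def by (auto dest: dvd_mult_right)
      then obtain v where v: "v \<in> mult_lattice K" "w = int K1 *s v" by (rule mult_lattice_mult)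
      obtain n where "v = (\<Sum>j\<in>{1..D}. n j *s c j)" using span v by blast
      then have w: "w = (\<Sum>j\<in>{1..D}. (int K1 * n j) *s c j)"
        unfolding v by (simp add: vec_eq_iff sum_distrib_left mult_ac)
      show ?thesis
        unfolding w using near_invariant_sum[of "{1..D}" "\<lambda>j. (int K1 * n j) *s c j" "A f" d] inv A fV
        by auto
    qed
    then have "nrm (B' (A f) - A f) \<le> real D * d"
      using A fV by (intro Av_near_invariant[OF B'(1)]) auto
    moreover have "nrm (A f) \<le> nrm (B' (A f)) + nrm (A f - B' (A f))"
      using A B' fV by (intro nrm_triangle_diff) auto
    moreover have "nrm (A f - B' (A f)) = nrm (B' (A f) - A f)"
      using A B' fV by (intro nrm_minus_commute) auto
    \<comment> \<open>Commuting \<open>B'\<close> past \<open>A\<close> brings in the near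
      minimality of \<open>B' f\<close>. As \<open>B'\<close> almost fixes \<open>A f\<close>, this
      bounds \<open>A f\<close> itself.\<close>
    moreover have "nrm (B' (A f)) \<le> nrm (B' f)"
      using Av_commute[OF A B'(1), of f] Av_nrm[OF A, of "B' f"] B' fV by auto
    ultimately have Af: "nrm (A f) \<le> rho n0 + h + real D * d" using B' by simp
    obtain N where N: "N > 0" "nrm (avg (\<lambda>t. vpoly c D (int Q * int t)) N f) \<le> nrm (A f) + d"
      using eventually_happens[OF eventually_conj[OF ev eventually_gt_at_top[of 0]]] by auto
    let ?A = "avg (\<lambda>t. vpoly c D (int Q * int t)) N"
    have A': "?A \<in> Av (range (\<lambda>t. vpoly c D (int Q * int t)))" by (rule avg_in_Av[OF N(1)])
    \<comment> \<open>The curve stays in the lattice of \<open>k\<close>, so its average competes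
      with \<open>B\<close> in the same minimisation.\<close>
    have "?A \<in> Av (mult_lattice k)" by (rule Av_mono[OF A']) (use c in auto)
    moreover have "?A \<in> Av (range (\<lambda>t. vpoly c D (int t)))"
      by (rule Av_mono[OF A']) (auto simp flip: of_nat_mult)
    moreover have "nrm (?A f) \<le> minnrm (mult_lattice k) f + 3 * h"
      using N Af d h by (simp add: rho_def k_def)
    ultimately show "\<exists>A\<in>Av (range (\<lambda>t. vpoly c D (int t))). nrm (A f - B f) \<le> e"
      using h B B3 \<open>e > 0\<close> by (intro bexI[of _ ?A] near_min_close[OF fV f1, of "3 * h" _ "mult_lattice k"]) auto
  qed
qed

end

section \<open>Polynomial curves in orbits\<close>

lemma int_poly_fun_subst:
  assumes "int_poly_fun q" "\<And>j. int_poly_fun (p j)"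
  shows "int_poly_fun (\<lambda>y. q (\<lambda>j. p j y))"
  using assms(1) by (induction rule: int_poly_fun.induct) (auto intro: int_poly_fun.intros assms(2))

lemma int_poly_fun_cong_mod:
  assumes "int_poly_fun q" "\<And>j. k dvd x j - y j"
  shows "k dvd q x - q y"
  using assms(1)
proof (induction rule: int_poly_fun.induct)
  case (add p q)
  then show ?case using dvd_add[of k "p x - p y" "q x - q y"] by (simp add: algebra_simps)
next
  case (mult p q)
  have "p x * q x - p y * q y = (p x - p y) * q x + p y * (q x - q y)" by (simp add: algebra_simps)
  then show ?case using mult by simp
qed (use assms(2) in auto)

abbreviation (input) with_time :: "int \<Rightarrow> int ^ 'd \<Rightarrow> 'd option \<Rightarrow> int" where
  "with_time t x \<equiv> \<lambda>j. case j of None \<Rightarrow> t | Some l \<Rightarrow> x $ l"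

lemma polynomial_walkE:
  assumes "polynomial_walk s"
  obtains q where "\<And>i. int_poly_fun (q i)" "\<And>i n x. s n x $ i = q i (with_time (int n) x)"
    "\<And>x. s 0 x = x"
proof -
  from assms have "\<forall>i. \<exists>q. int_poly_fun q \<and> (\<forall>n x. s n x $ i = q (with_time (int n) x))"
    and "s 0 = id" unfolding polynomial_walk_def by blast+
  then show thesis using that by (metis id_apply)
qed

lemma polynomial_walkI:
  assumes "\<And>i. int_poly_fun (q i)" "\<And>i n x. s n x $ i = q i (with_time (int n) x)"
    "\<And>x. s 0 x = x"
  shows "polynomial_walk s"
  unfolding polynomial_walk_def using assms by (metis eq_id_iff)

lemma polynomial_walk_speedup:
  assumes "polynomial_walk s"
  shows "polynomial_walk (\<lambda>n. s (m * n))"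
proof -
  obtain q where q: "\<And>i. int_poly_fun (q i)" "\<And>i n x. s n x $ i = q i (with_time (int n) x)"
    "\<And>x. s 0 x = x" using polynomial_walkE[OF assms(1)] by blast
  define p where "p j = (\<lambda>y::'a option \<Rightarrow> int. case j of None \<Rightarrow> int m * y None | Some l \<Rightarrow> y (Some l))" for j
  have "int_poly_fun (p j)" for j
    by (cases j) (auto simp: p_def intro: int_poly_fun.intros)
  then have "int_poly_fun (\<lambda>y. q i (\<lambda>j. p j y))" for i by (rule int_poly_fun_subst[OF q(1)])
  moreover have "p j (with_time (int n) x) = with_time (int (m * n)) x j" for j n x
    by (cases j) (auto simp: p_def)
  ultimately show ?thesis
    by (intro polynomial_walkI[of "\<lambda>i y. q i (\<lambda>j. p j y)"]) (simp_all add: q)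
qed

lemma polynomial_walk_comp:
  assumes "polynomial_walk s" "polynomial_walk s'"
  shows "polynomial_walk (\<lambda>n. s n \<circ> s' n)"
proof -
  obtain q where q: "\<And>i. int_poly_fun (q i)" "\<And>i n x. s n x $ i = q i (with_time (int n) x)"
    "\<And>x. s 0 x = x" using polynomial_walkE[OF assms(1)] by blast
  obtain q' where q': "\<And>i. int_poly_fun (q' i)" "\<And>i n x. s' n x $ i = q' i (with_time (int n) x)"
    "\<And>x. s' 0 x = x" using polynomial_walkE[OF assms(2)] by blast
  define p where "p j = (\<lambda>y::'a option \<Rightarrow> int. case j of None \<Rightarrow> y None | Some l \<Rightarrow> q' l y)" for j
  have "int_poly_fun (p j)" for j
    by (cases j) (auto simp: p_def intro: int_poly_fun.intros q')
  then have "int_poly_fun (\<lambda>y. q i (\<lambda>j. p j y))" for i by (rule int_poly_fun_subst[OF q(1)])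
  moreover have "p j (with_time (int n) x) = with_time (int n) (s' n x) j" for j n x
    by (cases j) (auto simp: p_def q')
  ultimately show ?thesis
    by (intro polynomial_walkI[of "\<lambda>i y. q i (\<lambda>j. p j y)"]) (simp_all add: q q'(3))
qed

text \<open>A generator \<open>s j n\<close> is reached at time 1 by running \<open>s j\<close> at
  \<open>n\<close>-fold speed, and a product by running both walks simultaneously.\<close>

lemma gen_semigroup_walk:
  assumes "\<gamma> \<in> gen_semigroup {s j n | j n. j < r}" "\<forall>j<r. polynomial_walk (s j)"
  shows "\<exists>G. polynomial_walk G \<and> (\<forall>n. G n \<in> gen_semigroup {s j n | j n. j < r}) \<and> G 1 = \<gamma>"
  using assms(1)
proof (induction rule: gen_semigroup.induct)
  case (base f)
  then obtain j n where "f = s j n" "j < r" by auto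
  then show ?case
    using assms(2) by (intro exI[of _ "\<lambda>m. s j (n * m)"]) (auto intro: polynomial_walk_speedup gen_semigroup.base)
next
  case (comp f g)
  then obtain F G where "polynomial_walk F" "\<forall>n. F n \<in> gen_semigroup {s j n | j n. j < r}" "F 1 = f"
    "polynomial_walk G" "\<forall>n. G n \<in> gen_semigroup {s j n | j n. j < r}" "G 1 = g" by blast
  then have "polynomial_walk (\<lambda>n. F n \<circ> G n)" "F n \<circ> G n \<in> gen_semigroup {s j n | j n. j < r}"
    "F 1 \<circ> G 1 = f \<circ> g" for n by (simp_all add: polynomial_walk_comp gen_semigroup.comp)
  then show ?case by blast
qed

section \<open>Walks run for polynomial times\<close>

definition int_coeffs :: "real poly \<Rightarrow> bool" where
  "int_coeffs p \<longleftrightarrow> (\<forall>i. coeff p i \<in> \<int>)"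

lemma int_coeffs_intros:
  "a \<in> \<int> \<Longrightarrow> int_coeffs [:a:]"
  "int_coeffs p \<Longrightarrow> int_coeffs q \<Longrightarrow> int_coeffs (p + q)"
  "int_coeffs p \<Longrightarrow> int_coeffs q \<Longrightarrow> int_coeffs (p * q)"
  "a \<in> \<int> \<Longrightarrow> int_coeffs p \<Longrightarrow> int_coeffs (pCons a p)"
  "a \<in> \<int> \<Longrightarrow> int_coeffs p \<Longrightarrow> int_coeffs (smult a p)"
  "int_coeffs 0" "int_coeffs 1"
  by (auto simp: int_coeffs_def coeff_mult coeff_pCons split: nat.split)

lemma int_coeffs_prod: "(\<And>i. i \<in> I \<Longrightarrow> int_coeffs (p i)) \<Longrightarrow> int_coeffs (\<Prod>i\<in>I. p i)"
  by (induction I rule: infinite_finite_induct) (auto intro: int_coeffs_intros)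

lemma int_coeffs_power: "int_coeffs p \<Longrightarrow> int_coeffs (p ^ n)"
  by (induction n) (auto intro: int_coeffs_intros)

text \<open>The points \<open>z\<close> are real on purpose: at a non-integral \<open>z\<close> the polynomials may still take
  integer values, and the interpolation nodes below are of this kind.\<close>

lemma int_poly_fun_poly:
  assumes "int_poly_fun q" "\<And>j. int_coeffs (X j)"
  shows "\<exists>p. int_coeffs p \<and>
    (\<forall>z y. (\<forall>j. poly (X j) z = real_of_int (y j)) \<longrightarrow> poly p z = real_of_int (q y))"
  using assms(1)
proof (induction rule: int_poly_fun.induct)
  case (const c)
  show ?case by (intro exI[of _ "[:real_of_int c:]"]) (auto intro: int_coeffs_intros)
next
  case (var i)
  show ?case using assms(2) by (intro exI[of _ "X i"]) auto
next
  case (add p q)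
  then obtain p' q' where "int_coeffs p'" "int_coeffs q'"
    "\<forall>z y. (\<forall>j. poly (X j) z = real_of_int (y j)) \<longrightarrow> poly p' z = real_of_int (p y)"
    "\<forall>z y. (\<forall>j. poly (X j) z = real_of_int (y j)) \<longrightarrow> poly q' z = real_of_int (q y)" by blast
  moreover from this have "poly (p' + q') z = real_of_int (p y + q y)"
    if "\<forall>j. poly (X j) z = real_of_int (y j)" for z y
    using that by (metis of_int_add poly_add)
  ultimately show ?case by (blast intro: int_coeffs_intros)
next
  case (mult p q)
  then obtain p' q' where "int_coeffs p'" "int_coeffs q'"
    "\<forall>z y. (\<forall>j. poly (X j) z = real_of_int (y j)) \<longrightarrow> poly p' z = real_of_int (p y)"
    "\<forall>z y. (\<forall>j. poly (X j) z = real_of_int (y j)) \<longrightarrow> poly q' z = real_of_int (q y)" by blast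
  moreover from this have "poly (p' * q') z = real_of_int (p y * q y)"
    if "\<forall>j. poly (X j) z = real_of_int (y j)" for z y
    using that by (metis of_int_mult poly_mult)
  ultimately show ?case by (blast intro: int_coeffs_intros)
qed

primrec concat_walks :: "(nat \<Rightarrow> nat \<Rightarrow> 'b \<Rightarrow> 'b) \<Rightarrow> (nat \<Rightarrow> nat) \<Rightarrow> nat \<Rightarrow> 'b \<Rightarrow> 'b" where
  "concat_walks G a 0 x = x"
| "concat_walks G a (Suc n) x = G n (a n) (concat_walks G a n x)"

lemma concat_walks_idle:
  assumes "\<And>i x. i < n \<Longrightarrow> G i 0 x = x" "\<And>i. i < n \<Longrightarrow> a i = 0"
  shows "concat_walks G a n x = x"
  using assms by (induction n) auto

text \<open>Walks with time 0 are idle. At the interpolation nodes the times form a unit vector, so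
  the concatenation recovers one chosen orbit point.\<close>

lemma concat_walks_single:
  assumes "\<And>i x. i < n \<Longrightarrow> G i 0 x = x" "j < n"
  shows "concat_walks G (\<lambda>i. if i = j then 1 else 0) n x = G j 1 x"
  using assms
proof (induction n)
  case (Suc n)
  show ?case
  proof (cases "j = n")
    case True
    then show ?thesis using Suc.prems concat_walks_idle[of n G "\<lambda>i. if i = j then 1 else 0" x] by simp
  qed (use Suc in auto)
qed simp

text \<open>At least one walk is concatenated, as \<open>gen_semigroup\<close> need not contain the
  identity.\<close>

lemma concat_walks_in:
  assumes "\<And>i m. i < Suc n \<Longrightarrow> G i m \<in> gen_semigroup S"
  shows "concat_walks G a (Suc n) x \<in> (\<lambda>\<gamma>. \<gamma> x) ` gen_semigroup S"
  using assms
proof (induction n)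
  case 0
  then show ?case by auto
next
  case (Suc n)
  then obtain \<gamma> where "\<gamma> \<in> gen_semigroup S" "concat_walks G a (Suc n) x = \<gamma> x" by fastforce
  then have "G (Suc n) (a (Suc n)) \<circ> \<gamma> \<in> gen_semigroup S"
    "concat_walks G a (Suc (Suc n)) x = (G (Suc n) (a (Suc n)) \<circ> \<gamma>) x"
    using Suc.prems by (auto intro: gen_semigroup.comp)
  then show ?case by (metis image_eqI)
qed

text \<open>Integer polynomials respect congruences, so at times divisible by \<open>k\<close> the
  walk agrees modulo \<open>k\<close> with its position at time 0.\<close>

lemma polynomial_walk_mod:
  assumes "polynomial_walk s" "k dvd n" "x \<in> mult_lattice k"
  shows "s n x \<in> mult_lattice k"
proof -
  obtain q where q: "\<And>i. int_poly_fun (q i)" "\<And>i n x. s n x $ i = q i (with_time (int n) x)"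
    "\<And>x. s 0 x = x" using polynomial_walkE[OF assms(1)] by blast
  have "int k dvd s n x $ i - s 0 x $ i" for i
    unfolding q(2) using assms(2) by (intro int_poly_fun_cong_mod[OF q(1)]) (auto split: option.split)
  then have "int k dvd s n x $ i - x $ i" for i by (simp add: q(3))
  then have "int k dvd (s n x $ i - x $ i) + x $ i" for i
    using assms(3) by (intro dvd_add) (auto simp: mult_lattice_def)
  then show ?thesis by (simp add: mult_lattice_def)
qed

lemma concat_walks_mod:
  assumes "\<And>i. i < n \<Longrightarrow> polynomial_walk (G i)" "\<And>i. i < n \<Longrightarrow> k dvd a i" "x \<in> mult_lattice k"
  shows "concat_walks G a n x \<in> mult_lattice k"
  using assms
proof (induction n)
  case (Suc n)
  then have "concat_walks G a n x \<in> mult_lattice k" by simp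
  then show ?case using polynomial_walk_mod[of "G n" k "a n"] Suc.prems by simp
qed simp

text \<open>Substitution of one-variable polynomials for the time and the starting point. The
  resulting \<open>Y\<close> is valid at every real \<open>z\<close> where these inputs take the
  required integer values.\<close>

lemma polynomial_walk_poly:
  assumes "polynomial_walk s" "int_coeffs \<Lambda>" "\<And>l. int_coeffs (X l)"
  shows "\<exists>Y. (\<forall>l. int_coeffs (Y l)) \<and> (\<forall>z n x. poly \<Lambda> z = real n \<longrightarrow>
    (\<forall>l. poly (X l) z = real_of_int (x $ l)) \<longrightarrow> (\<forall>l. poly (Y l) z = real_of_int (s n x $ l)))"
proof -
  obtain q where q: "\<And>i. int_poly_fun (q i)" "\<And>i n x. s n x $ i = q i (with_time (int n) x)"
    "\<And>x. s 0 x = x" using polynomial_walkE[OF assms(1)] by blast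
  let ?X = "\<lambda>j. case j of None \<Rightarrow> \<Lambda> | Some l \<Rightarrow> X l"
  have "int_coeffs (?X j)" for j using assms by (cases j) auto
  then have "\<forall>l. \<exists>p. int_coeffs p \<and> (\<forall>z y. (\<forall>j. poly (?X j) z = real_of_int (y j)) \<longrightarrow> poly p z = real_of_int (q l y))"
    using int_poly_fun_poly[OF q(1), of ?X] by blast
  then obtain Y where Y: "\<And>l. int_coeffs (Y l)"
    "\<And>l z y. (\<forall>j. poly (?X j) z = real_of_int (y j)) \<Longrightarrow> poly (Y l) z = real_of_int (q l y)"
    by metis
  show ?thesis
  proof (intro exI[of _ Y] conjI allI impI Y(1))
    fix z n x l
    assume "poly \<Lambda> z = real n" "\<forall>l. poly (X l) z = real_of_int (x $ l)"
    then have "\<forall>j. poly (?X j) z = real_of_int (with_time (int n) x j)" by (auto split: option.split)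
    then show "poly (Y l) z = real_of_int (s n x $ l)" using Y(2) q(2) by metis
  qed
qed

text \<open>Iterated substitution, the endpoint of one walk being the starting point of the next.
  The same \<open>Y\<close> describes the curve at integers and at the interpolation nodes.\<close>

lemma concat_walks_poly:
  assumes "\<And>i. i < n \<Longrightarrow> polynomial_walk (G i)" "\<And>i. i < n \<Longrightarrow> int_coeffs (\<Lambda> i)"
  shows "\<exists>Y. (\<forall>l. int_coeffs (Y l)) \<and> (\<forall>z a. (\<forall>i<n. poly (\<Lambda> i) z = real (a i)) \<longrightarrow>
    (\<forall>l. poly (Y l) z = real_of_int (concat_walks G a n v $ l)))"
  using assms
proof (induction n)
  case 0
  show ?case by (intro exI[of _ "\<lambda>l. [:real_of_int (v $ l):]"]) (auto intro: int_coeffs_intros)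
next
  case (Suc n)
  then obtain Y where Y: "\<And>l. int_coeffs (Y l)" "\<And>z a. (\<forall>i<n. poly (\<Lambda> i) z = real (a i)) \<Longrightarrow>
    (\<forall>l. poly (Y l) z = real_of_int (concat_walks G a n v $ l))" by force
  obtain Y' where Y': "\<And>l. int_coeffs (Y' l)" "\<And>z m x. poly (\<Lambda> n) z = real m \<Longrightarrow>
    (\<forall>l. poly (Y l) z = real_of_int (x $ l)) \<Longrightarrow> (\<forall>l. poly (Y' l) z = real_of_int (G n m x $ l))"
    using polynomial_walk_poly[of "G n" "\<Lambda> n" Y] Suc.prems Y(1) by blast
  show ?case
    using Y Y' by (intro exI[of _ Y']) auto
qed

text \<open>The polynomials are squares, because times have to be nonnegative; the nodes are the rational
  numbers \<open>(j + 1) / K\<close>, where \<open>K\<close> clears the denominators of the Lagrange polynomials.\<close>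

lemma interpolation_times:
  assumes "k > 0"
  obtains \<Lambda> :: "nat \<Rightarrow> real poly" and z :: "nat \<Rightarrow> real" where
    "\<And>i. int_coeffs (\<Lambda> i)"
    "\<And>i (t::int). \<exists>b::nat. poly (\<Lambda> i) (of_int t) = real (k * b)"
    "\<And>i j. i < n \<Longrightarrow> j < n \<Longrightarrow> poly (\<Lambda> i) (z j) = (if i = j then 1 else 0)"
proof -
  \<comment> \<open>The Lagrange denominator, with the extra factor \<open>i + 1\<close> from the
    numerator of the node.\<close>
  define E where "E i = (int i + 1) * (\<Prod>j\<in>{..<n} - {i}. int i - int j)" for i
  have E0: "E i \<noteq> 0" for i by (auto simp: E_def)
  define K where "K = int k * (\<Prod>i<n. E i)"
  have K0: "K \<noteq> 0" using assms E0 by (auto simp: K_def)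
  define C where "C i = (\<Prod>j\<in>{..<n} - {i}. E j)" for i
  have KC: "K = int k * C i * E i" if "i < n" for i
    using that unfolding K_def C_def by (subst prod.remove[of _ i]) auto
  \<comment> \<open>The products vanish at the other nodes. At its own node the linear factor
    supplies the division by \<open>K\<close> while its coefficients stay integral, giving
    \<open>k * C i * E i / K = 1\<close>. The factor \<open>k\<close> makes the values at integers
    divisible by \<open>k\<close>.\<close>
  define h where "h i = [:0, real_of_int (int k * C i):] *
    (\<Prod>j\<in>{..<n} - {i}. [:- real_of_int (int j + 1), real_of_int K:])" for i
  have ph: "poly (h i) x = x * real_of_int (int k * C i) * (\<Prod>j\<in>{..<n} - {i}. x * real_of_int K - real_of_int (int j + 1))"
    for i x
  proof -
    have "poly [:- real_of_int (int j + 1), real_of_int K:] x = x * real_of_int K - real_of_int (int j + 1)" for j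
      by simp
    then show ?thesis unfolding h_def poly_mult poly_prod by (simp only:) simp
  qed
  show thesis
  proof
    show "int_coeffs (h i ^ 2)" for i
      unfolding h_def by (intro int_coeffs_power int_coeffs_intros int_coeffs_prod) auto
    show "\<exists>b::nat. poly (h i ^ 2) (of_int t) = real (k * b)" for i and t :: int
    proof -
      define u where "u = t * C i * (\<Prod>j\<in>{..<n} - {i}. t * K - (int j + 1))"
      have "poly (h i) (of_int t) = real k * real_of_int u"
        by (simp add: ph u_def)
      then have "poly (h i ^ 2) (of_int t) = real k * (real k * real_of_int (u\<^sup>2))"
        by (simp add: poly_power power2_eq_square)
      also have "\<dots> = real (k * (k * nat (u\<^sup>2)))" by simp
      finally show ?thesis by blast
    qed
    show "poly (h i ^ 2) (real_of_int (int j + 1) / real_of_int K) = (if i = j then 1 else 0)"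
      if ij: "i < n" "j < n" for i j
    proof (cases "i = j")
      case False
      then have "(\<Prod>l\<in>{..<n} - {i}. real_of_int (int j + 1) / real_of_int K * real_of_int K - real_of_int (int l + 1)) = 0"
        using ij K0 by (intro prod_zero) auto
      then show ?thesis using False by (simp add: ph poly_power)
    next
      case True
      have "(\<Prod>l\<in>{..<n} - {i}. real_of_int (int i + 1) / real_of_int K * real_of_int K - real_of_int (int l + 1))
        = (\<Prod>l\<in>{..<n} - {i}. real_of_int (int i - int l))"
        using K0 by (intro prod.cong) auto
      then have "poly (h i) (real_of_int (int i + 1) / real_of_int K)
        = real_of_int (int k * C i * E i) / real_of_int K"
        by (simp add: ph E_def)
      then have "poly (h i) (real_of_int (int i + 1) / real_of_int K) = 1"
        using K0 KC[OF ij(1)] by simp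
      then show ?thesis using True by (simp add: poly_power)
    qed
  qed
qed

lemma vpoly_nth: "real_of_int (vpoly c D t $ l) = (\<Sum>j\<le>D. real_of_int (c j $ l) * real_of_int t ^ j)"
  by (simp add: vpoly_def mult.commute)

section \<open>Curves in orbits and the lattices spanned by their coefficients\<close>

text \<open>Walks to finitely many affinely spanning orbit points are concatenated, with times
  \<open>\<Lambda> i\<close> at parameter \<open>t\<close>. At integers the times are nonnegative
  multiples of \<open>k\<close>, so the curve stays in the orbit and in the lattice. At the nodes
  the polynomials pass through the spanning points, so no nonzero \<open>a\<close> is orthogonal to
  all nonconstant coefficients.\<close>

lemma polynomial_path:
  fixes s :: "nat \<Rightarrow> nat \<Rightarrow> int ^ 'd \<Rightarrow> int ^ 'd"
  assumes walks: "\<forall>j<r. polynomial_walk (s j)"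
    and \<Gamma>: "\<Gamma> = gen_semigroup {s j n | j n. j < r}"
    and flee: "hyperplane_fleeing ((\<lambda>\<gamma>. real_of_intvec (\<gamma> v)) ` \<Gamma>)"
    and "k > 0" and v: "v \<in> mult_lattice k"
  obtains c D where "\<And>t. vpoly c D t \<in> mult_lattice k" "\<And>t. vpoly c D t \<in> (\<lambda>\<gamma>. \<gamma> v) ` \<Gamma>"
    "\<And>a. (\<And>j. j \<in> {1..D} \<Longrightarrow> a \<bullet> real_of_intvec (c j) = 0) \<Longrightarrow> a = 0"
proof -
  let ?A = "(\<lambda>\<gamma>. real_of_intvec (\<gamma> v)) ` \<Gamma>"
  obtain B where B: "B \<subseteq> ?A" "\<not> affine_dependent B" "affine hull ?A = affine hull B"
    using affine_basis_exists[of ?A] by blast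
  have "affine hull ?A = UNIV"
    using flee hull_subset[of ?A affine] affine_affine_hull[of ?A] unfolding hyperplane_fleeing_def by blast
  then have hullB: "affine hull B = UNIV" using B by simp
  have finB: "finite B" using B by (simp add: aff_independent_finite)
  obtain n b where b: "B = b ` {i::nat. i < n}" using finB finite_imp_nat_seg_image_inj_on by metis
  have "n \<noteq> 0"
  proof
    assume "n = 0"
    then have "B = {}" using b by simp
    then show False using hullB by simp
  qed
  then obtain n' where n': "n = Suc n'" using not0_implies_Suc by blast
  have "\<forall>i. \<exists>G. i < n \<longrightarrow> polynomial_walk G \<and> (\<forall>m. G m \<in> \<Gamma>) \<and> real_of_intvec (G 1 v) = b i"
  proof (intro allI)
    fix i
    show "\<exists>G. i < n \<longrightarrow> polynomial_walk G \<and> (\<forall>m. G m \<in> \<Gamma>) \<and> real_of_intvec (G 1 v) = b i"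
    proof (cases "i < n")
      case True
      then have "b i \<in> ?A" using B b by auto
      then obtain \<gamma> where "\<gamma> \<in> \<Gamma>" "b i = real_of_intvec (\<gamma> v)" by auto
      then obtain G where "polynomial_walk G" "\<forall>m. G m \<in> \<Gamma>" "G 1 = \<gamma>"
        using gen_semigroup_walk[OF _ walks, of \<gamma>] unfolding \<Gamma> by blast
      then show ?thesis using \<open>b i = _\<close> by (intro exI[of _ G]) simp
    qed auto
  qed
  from choice[OF this] obtain G where G: "\<And>i. i < n \<Longrightarrow> polynomial_walk (G i)" "\<And>i m. i < n \<Longrightarrow> G i m \<in> \<Gamma>"
    "\<And>i. i < n \<Longrightarrow> real_of_intvec (G i 1 v) = b i" by blast
  have G0: "G i 0 x = x" if "i < n" for i x
    using G(1)[OF that] unfolding polynomial_walk_def by simp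
  obtain \<Lambda> z where \<Lambda>: "\<And>i. int_coeffs (\<Lambda> i)"
    "\<And>i (t::int). \<exists>b::nat. poly (\<Lambda> i) (of_int t) = real (k * b)"
    "\<And>i j. i < n \<Longrightarrow> j < n \<Longrightarrow> poly (\<Lambda> i) (z j) = (if i = j then 1 else 0)"
    using interpolation_times[OF \<open>k > 0\<close>, of n] by blast
  obtain Y where Y: "\<And>l. int_coeffs (Y l)" "\<And>z a. (\<forall>i<n. poly (\<Lambda> i) z = real (a i)) \<Longrightarrow>
    (\<forall>l. poly (Y l) z = real_of_int (concat_walks G a n v $ l))"
    using concat_walks_poly[of n G \<Lambda> v] G \<Lambda> by blast
  \<comment> \<open>The floor is exact, since the coefficients are integers.\<close>
  define c where "c j = (\<chi> l. \<lfloor>coeff (Y l) j\<rfloor>)" for j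
  have c: "real_of_int (c j $ l) = coeff (Y l) j" for j l
    using Y(1)[of l] by (simp add: c_def int_coeffs_def)
  define D where "D = Max (range (\<lambda>l. degree (Y l)))"
  have D: "degree (Y l) \<le> D" for l by (simp add: D_def)
  have poly_Y: "poly (Y l) x = (\<Sum>j\<le>D. real_of_int (c j $ l) * x ^ j)" for l x
    unfolding poly_altdef c by (rule sum.mono_neutral_left) (use D in \<open>auto simp: coeff_eq_0\<close>)
  have path: "\<exists>a. (\<forall>i<n. k dvd a i) \<and> vpoly c D t = concat_walks G a n v" for t
  proof -
    have "\<forall>i. \<exists>b. poly (\<Lambda> i) (of_int t) = real (k * b)" using \<Lambda>(2) by blast
    from choice[OF this] obtain a where a: "\<And>i. poly (\<Lambda> i) (of_int t) = real (k * a i)" by blast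
    have "\<forall>l. poly (Y l) (of_int t) = real_of_int (concat_walks G (\<lambda>i. k * a i) n v $ l)"
      by (rule Y(2)) (use a in auto)
    then have "real_of_int (vpoly c D t $ l) = real_of_int (concat_walks G (\<lambda>i. k * a i) n v $ l)" for l
      unfolding vpoly_nth poly_Y by auto
    then have "vpoly c D t = concat_walks G (\<lambda>i. k * a i) n v" by (simp add: vec_eq_iff)
    then show ?thesis by (intro exI[of _ "\<lambda>i. k * a i"]) auto
  qed
  show thesis
  proof
    show "vpoly c D t \<in> mult_lattice k" for t
      using path[of t] concat_walks_mod[of n G k _ v] G v by auto
    show "vpoly c D t \<in> (\<lambda>\<gamma>. \<gamma> v) ` \<Gamma>" for t
      using path[of t] concat_walks_in[of n' G "{s j n | j n. j < r}" _ v] G(2) unfolding n' \<Gamma> by auto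
    fix a assume a: "\<And>j. j \<in> {1..D} \<Longrightarrow> a \<bullet> real_of_intvec (c j) = 0"
    have inner_c: "a \<bullet> real_of_intvec (c j) = (\<Sum>l\<in>UNIV. a $ l * real_of_int (c j $ l))" for j
      by (simp add: inner_vec_def real_of_intvec_def)
    \<comment> \<open>The pairing of \<open>a\<close> with the curve is constant at all real
      parameters, in particular at the nodes. Hence all spanning points lie on one level set of
      \<open>a\<close>.\<close>
    have const: "(\<Sum>l\<in>UNIV. a $ l * poly (Y l) x) = a \<bullet> real_of_intvec (c 0)" for x
    proof -
      have "(\<Sum>l\<in>UNIV. a $ l * poly (Y l) x) = (\<Sum>j\<le>D. (a \<bullet> real_of_intvec (c j)) * x ^ j)"
        unfolding poly_Y inner_c sum_distrib_left sum_distrib_right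
        by (subst sum.swap) (simp only: mult.assoc)
      also have "\<dots> = (\<Sum>j\<in>{0}. (a \<bullet> real_of_intvec (c j)) * x ^ j)"
        using a by (intro sum.mono_neutral_right) auto
      finally show ?thesis by simp
    qed
    have "a \<bullet> b i = a \<bullet> real_of_intvec (c 0)" if "i < n" for i
    proof -
      have "\<forall>l. poly (Y l) (z i) = real_of_int (concat_walks G (\<lambda>j. if j = i then 1 else 0) n v $ l)"
        by (rule Y(2)) (use \<Lambda>(3) that in auto)
      also have "concat_walks G (\<lambda>j. if j = i then 1 else 0) n v = G i 1 v"
        by (rule concat_walks_single) (use G0 that in auto)
      finally have "\<forall>l. b i $ l = poly (Y l) (z i)" by (simp add: real_of_intvec_def flip: G(3)[OF that])
      then show ?thesis using const[of "z i"] by (simp add: inner_vec_def)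
    qed
    then have "affine hull B \<subseteq> {x. a \<bullet> x = a \<bullet> real_of_intvec (c 0)}"
      unfolding b by (intro hull_minimal affine_hyperplane) auto
    then have "a \<bullet> x = a \<bullet> real_of_intvec (c 0)" for x using hullB by auto
    \<comment> \<open>Comparing \<open>x = a\<close> with \<open>x = 0\<close> gives
      \<open>a \<bullet> a = 0\<close>.\<close>
    from this[of a] this[of 0] show "a = 0" by simp
  qed
qed

lemma det_of_int: "det (\<chi> i j. real_of_int (A $ i $ j)) = real_of_int (det (A :: int ^ 'd ^ 'd))"
  by (simp add: det_def)

text \<open>Among the spanning integer vectors there is a basis, the columns of a matrix
  \<open>A\<close> with determinant \<open>\<delta> \<noteq> 0\<close>. For right-hand sides
  divisible by \<open>\<delta>\<close>, Cramer's rule gives an integral solution, so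
  \<open>K = |\<delta>|\<close> works.\<close>

lemma int_span_contains_lattice:
  fixes c :: "nat \<Rightarrow> int ^ 'd"
  assumes "\<And>a. (\<And>j. j \<in> J \<Longrightarrow> a \<bullet> real_of_intvec (c j) = 0) \<Longrightarrow> a = 0" and "finite J"
  obtains K where "K > 0" "\<And>w. w \<in> mult_lattice K \<Longrightarrow> \<exists>n. w = (\<Sum>j\<in>J. n j *s c j)"
proof -
  let ?S = "(\<lambda>j. real_of_intvec (c j)) ` J"
  have "span ?S = UNIV"
  proof (rule ccontr)
    assume "span ?S \<noteq> UNIV"
    then obtain a where "a \<noteq> 0" "\<forall>x\<in>span ?S. a \<bullet> x = 0" using span_not_UNIV_orthogonal by blast
    then show False using assms(1)[of a] by (auto intro: span_base)
  qed
  then obtain B where B: "B \<subseteq> ?S" "independent B" "span B = UNIV"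
    by (metis maximal_independent_subset span_mono span_span top.extremum_uniqueI)
  have "card B = CARD('d)" using B by (metis dim_UNIV dim_eq_card DIM_cart DIM_real mult.right_neutral span_UNIV)
  moreover have "finite B" using B finite_subset[OF B(1)] assms(2) by simp
  ultimately obtain f :: "'d \<Rightarrow> real ^ 'd" where f: "bij_betw f UNIV B"
    using finite_same_card_bij[of "UNIV :: 'd set" B] by auto
  have "\<forall>m. \<exists>j\<in>J. f m = real_of_intvec (c j)" using f B by (auto simp: bij_betw_def)
  then obtain g where g: "\<And>m. g m \<in> J" "\<And>m. f m = real_of_intvec (c (g m))" by metis
  define A where "A = (\<chi> i m. c (g m) $ i)"
  define R where "R = (\<chi> i m. real_of_int (A $ i $ m))"
  have "columns R = B"
  proof -
    have "column m R = f m" for m by (simp add: column_def R_def A_def g real_of_intvec_def)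
    then show ?thesis using f by (auto simp: columns_def bij_betw_def)
  qed
  then have "invertible R"
    using B by (simp add: invertible_right_inverse matrix_right_invertible_span_columns span_vec_eq)
  then have detR: "det R \<noteq> 0" by (simp add: invertible_det_nz)
  define \<delta> where "\<delta> = det A"
  have detA: "det R = real_of_int \<delta>" unfolding R_def \<delta>_def by (rule det_of_int)
  show thesis
  proof
    show "nat \<bar>\<delta>\<bar> > 0" using detR detA by simp
    fix w :: "int ^ 'd" assume w: "w \<in> mult_lattice (nat \<bar>\<delta>\<bar>)"
    then have "\<forall>l. \<delta> dvd w $ l" by (simp add: mult_lattice_def)
    then have "\<forall>l. \<exists>y. w $ l = \<delta> * y" by (simp add: dvd_def)
    then obtain y where y: "\<And>l. w $ l = \<delta> * y l" by metis
    \<comment> \<open>The Cramer numerators: they solve the system with right-hand side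
      \<open>\<delta> * y\<close>, that is, \<open>w\<close>.\<close>
    define x where "x m = det (\<chi> i j. if j = m then y i else A $ i $ j)" for m
    have "R *v (\<chi> m. real_of_int (x m) / det R) = (\<chi> i. real_of_int (y i))"
      unfolding cramer[OF detR]
    proof -
      have "det (\<chi> i j. if j = m then (\<chi> i. real_of_int (y i)) $ i else R $ i $ j) = real_of_int (x m)" for m
        unfolding x_def by (subst det_of_int[symmetric]) (simp add: R_def if_distrib cong: if_cong)
      then show "(\<chi> m. real_of_int (x m) / det R)
        = (\<chi> k. det (\<chi> i j. if j = k then (\<chi> i. real_of_int (y i)) $ i else R $ i $ j) / det R)" by simp
    qed
    then have "(\<Sum>m\<in>UNIV. R $ i $ m * (real_of_int (x m) / det R)) = real_of_int (y i)" for i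
      by (simp add: matrix_vector_mult_def vec_eq_iff)
    then have "(\<Sum>m\<in>UNIV. R $ i $ m * real_of_int (x m)) = real_of_int (\<delta> * y i)" for i
      using detR detA by (simp add: field_simps flip: sum_divide_distrib)
    then have "real_of_int (w $ i) = real_of_int (\<Sum>m\<in>UNIV. A $ i $ m * x m)" for i
      unfolding y R_def by simp
    then have w: "w = (\<Sum>m\<in>UNIV. x m *s c (g m))"
      unfolding of_int_eq_iff by (simp add: vec_eq_iff A_def mult.commute)
    also have "\<dots> = (\<Sum>j\<in>J. \<Sum>m | m \<in> UNIV \<and> g m = j. x m *s c (g m))"
      using g assms(2) by (intro sum.group[symmetric]) auto
    also have "\<dots> = (\<Sum>j\<in>J. (\<Sum>m | g m = j. x m) *s c j)"
      by (intro sum.cong) (auto simp: vec_eq_iff sum_distrib_right)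
    finally show "\<exists>n. w = (\<Sum>j\<in>J. n j *s c j)" by (rule exI[of _ "\<lambda>j. \<Sum>m | g m = j. x m"])
  qed
qed

section \<open>Multiple recurrence\<close>

text \<open>Pointwise scaling lets \<open>isometric_action\<close> be interpreted on functions
  themselves.\<close>

instantiation "fun" :: (type, real_vector) real_vector
begin

definition "scaleR a f = (\<lambda>x. a *\<^sub>R f x)"

instance
  by standard (simp_all add: scaleR_fun_def plus_fun_def scaleR_add_right scaleR_add_left)

end

locale mp_system = prob_space M for M :: "'a measure" +
  fixes T :: "int ^ 'd \<Rightarrow> 'a \<Rightarrow> 'a"
  assumes action: "mp_action M T"
begin

text \<open>Requiring the functions to vanish off \<open>space M\<close> makes \<open>koopman 0\<close> the identity on them.\<close>

definition bdd_fun :: "('a \<Rightarrow> real) set" where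
  "bdd_fun = {f \<in> borel_measurable M. (\<exists>C. \<forall>x. \<bar>f x\<bar> \<le> C) \<and> (\<forall>x. x \<notin> space M \<longrightarrow> f x = 0)}"

definition inner_prod :: "('a \<Rightarrow> real) \<Rightarrow> ('a \<Rightarrow> real) \<Rightarrow> real" where
  "inner_prod f g = (LINT x|M. f x * g x)"

definition koopman :: "int ^ 'd \<Rightarrow> ('a \<Rightarrow> real) \<Rightarrow> 'a \<Rightarrow> real" where
  "koopman w f = (\<lambda>x. if x \<in> space M then f (T w x) else 0)"

lemma T_measurable [measurable]: "T w \<in> M \<rightarrow>\<^sub>M M"
  using action unfolding mp_action_def by blast

lemma T_space: "x \<in> space M \<Longrightarrow> T w x \<in> space M"
  using T_measurable by (rule measurable_space)

lemma bdd_funD: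
  assumes "f \<in> bdd_fun"
  shows "f \<in> borel_measurable M" "x \<notin> space M \<Longrightarrow> f x = 0"
  using assms unfolding bdd_fun_def by blast+

lemma bdd_fun_integrable:
  assumes "f \<in> bdd_fun"
  shows "integrable M f"
proof -
  obtain C where "\<And>x. \<bar>f x\<bar> \<le> C" using assms unfolding bdd_fun_def by blast
  then show ?thesis using bdd_funD(1)[OF assms] by (intro integrable_const_bound[of _ C]) auto
qed

lemma bdd_fun_mult:
  assumes "f \<in> bdd_fun" "g \<in> bdd_fun"
  shows "(\<lambda>x. f x * g x) \<in> bdd_fun"
proof -
  obtain C D where "\<And>x. \<bar>f x\<bar> \<le> C" "\<And>x. \<bar>g x\<bar> \<le> D" using assms unfolding bdd_fun_def by blast
  then have "\<bar>f x * g x\<bar> \<le> C * D" for x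
    unfolding abs_mult by (intro mult_mono) (auto intro: order_trans[OF abs_ge_zero])
  then show ?thesis using assms unfolding bdd_fun_def by auto
qed

lemma bdd_fun_power: "f \<in> bdd_fun \<Longrightarrow> (\<lambda>x. f x ^ Suc n) \<in> bdd_fun"
  by (induction n) (auto intro: bdd_fun_mult)

lemma bdd_fun_abs: "f \<in> bdd_fun \<Longrightarrow> (\<lambda>x. \<bar>f x\<bar>) \<in> bdd_fun"
  unfolding bdd_fun_def by auto

lemma bdd_fun_indicator: "B \<in> sets M \<Longrightarrow> indicator B \<in> bdd_fun"
  unfolding bdd_fun_def using sets.sets_into_space
  by (auto intro!: exI[of _ 1] simp: indicator_def)

lemma bdd_fun_subspace: "subspace bdd_fun"
  unfolding subspace_def
proof (intro conjI ballI allI)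
  show "0 \<in> bdd_fun" unfolding bdd_fun_def by (auto simp: zero_fun_def)
next
  fix f g assume fg: "f \<in> bdd_fun" "g \<in> bdd_fun"
  then obtain C D where CD: "\<And>x. \<bar>f x\<bar> \<le> C" "\<And>x. \<bar>g x\<bar> \<le> D" unfolding bdd_fun_def by blast
  have "\<bar>f x + g x\<bar> \<le> C + D" for x using CD(1)[of x] CD(2)[of x] by linarith
  then show "f + g \<in> bdd_fun" using fg unfolding bdd_fun_def by (auto simp: plus_fun_def)
next
  fix a :: real and f assume f: "f \<in> bdd_fun"
  then obtain C where "\<And>x. \<bar>f x\<bar> \<le> C" unfolding bdd_fun_def by blast
  then have "\<bar>a * f x\<bar> \<le> \<bar>a\<bar> * C" for x by (simp add: abs_mult mult_left_mono)
  then show "a *\<^sub>R f \<in> bdd_fun" using f unfolding bdd_fun_def by (auto simp: scaleR_fun_def)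
qed

lemma koopman_bdd_fun:
  assumes "f \<in> bdd_fun"
  shows "koopman w f \<in> bdd_fun"
proof -
  obtain C where C: "\<And>x. \<bar>f x\<bar> \<le> C" using assms unfolding bdd_fun_def by blast
  then have "0 \<le> C" by (meson abs_ge_zero order_trans)
  have "koopman w f \<in> borel_measurable M \<longleftrightarrow> (\<lambda>x. f (T w x)) \<in> borel_measurable M"
    by (rule measurable_cong) (simp add: koopman_def)
  moreover have "(\<lambda>x. f (T w x)) \<in> borel_measurable M"
    using bdd_funD(1)[OF assms] by measurable
  ultimately show ?thesis
    using C \<open>0 \<le> C\<close> unfolding bdd_fun_def by (auto simp: koopman_def)
qed

lemma integral_koopman:
  assumes "f \<in> borel_measurable M"
  shows "(LINT x|M. koopman w f x) = (LINT x|M. f x)"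
proof -
  have "(LINT x|M. koopman w f x) = (LINT x|M. f (T w x))"
    by (rule Bochner_Integration.integral_cong) (auto simp: koopman_def)
  also have "\<dots> = (LINT x|distr M M (T w). f x)"
    using assms by (simp add: integral_distr)
  also have "distr M M (T w) = M" using action unfolding mp_action_def by blast
  finally show ?thesis .
qed

sublocale isometric_action bdd_fun inner_prod koopman
proof (rule isometric_action.intro)
  show "subspace bdd_fun" by (rule bdd_fun_subspace)
  show "inner_prod x y = inner_prod y x" for x y by (simp add: inner_prod_def mult.commute)
  show "inner_prod (x + y) z = inner_prod x z + inner_prod y z"
    if "x \<in> bdd_fun" "y \<in> bdd_fun" "z \<in> bdd_fun" for x y z
    using that by (simp add: inner_prod_def distrib_right bdd_fun_mult bdd_fun_integrable)
  show "inner_prod (a *\<^sub>R x) y = a * inner_prod x y" for a x y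
    by (simp add: inner_prod_def scaleR_fun_def mult.assoc)
  show "0 \<le> inner_prod x x" for x by (simp add: inner_prod_def)
  show "linear (koopman w)" for w
    by (rule linearI) (auto simp: koopman_def scaleR_fun_def)
  show "koopman w x \<in> bdd_fun" if "x \<in> bdd_fun" for x w using that by (rule koopman_bdd_fun)
  show "koopman (u + w) x = koopman u (koopman w x)" for u w x
  proof
    fix y
    \<comment> \<open>Composition with \<open>T\<close> reverses the order of the factors, which
      commutativity of addition repairs.\<close>
    have "T (u + w) y = T w (T u y)" if "y \<in> space M"
      using action that unfolding mp_action_def by (metis add.commute)
    then show "koopman (u + w) x y = koopman u (koopman w x) y"
      by (simp add: koopman_def T_space)
  qed
  show "koopman 0 x = x" if "x \<in> bdd_fun" for x
    using action bdd_funD(2)[OF that] unfolding mp_action_def koopman_def by auto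
  show "inner_prod (koopman w x) (koopman w y) = inner_prod x y"
    if "x \<in> bdd_fun" "y \<in> bdd_fun" for x y w
  proof -
    have "(\<lambda>z. koopman w x z * koopman w y z) = koopman w (\<lambda>z. x z * y z)"
      by (auto simp: koopman_def)
    then show ?thesis
      using integral_koopman[OF bdd_funD(1)[OF bdd_fun_mult[OF that]]] by (simp add: inner_prod_def)
  qed
qed

section \<open>Averages of an indicator function\<close>

lemma Av_unit:
  assumes "A \<in> Av L" "\<And>x. 0 \<le> f x \<and> f x \<le> 1"
  shows "0 \<le> A f x \<and> A f x \<le> 1"
  using assms(1)
proof (induction rule: Av.induct)
  case (U w)
  then show ?case using assms(2) by (simp add: koopman_def)
next
  case (cvx A B a)
  then have "a * A f x + (1 - a) * B f x \<le> a * 1 + (1 - a) * 1"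
    by (intro add_mono mult_left_mono) auto
  then show ?case using cvx by (simp add: scaleR_fun_def)
qed

lemma Av_integral:
  assumes "A \<in> Av L" "f \<in> bdd_fun"
  shows "(LINT x|M. A f x) = (LINT x|M. f x)"
  using assms(1)
proof (induction rule: Av.induct)
  case (U w)
  then show ?case using assms(2) by (intro integral_koopman bdd_funD)
next
  case (cvx A B a)
  have "integrable M (A f)" "integrable M (B f)" using cvx.hyps assms(2) by (auto intro: bdd_fun_integrable)
  then show ?case using cvx.IH by (simp add: scaleR_fun_def algebra_simps)
qed

text \<open>Cauchy-Schwarz against the constant 1, taken as the indicator of \<open>space M\<close>
  so that it belongs to \<open>bdd_fun\<close>.\<close>

lemma integral_abs_le_nrm:
  assumes "f \<in> bdd_fun"
  shows "(LINT x|M. \<bar>f x\<bar>) \<le> nrm f"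
proof -
  have "(LINT x|M. \<bar>f x\<bar>) = inner_prod (\<lambda>x. \<bar>f x\<bar>) (indicator (space M))"
    unfolding inner_prod_def by (rule Bochner_Integration.integral_cong) auto
  also have "\<dots> \<le> nrm (\<lambda>x. \<bar>f x\<bar>) * nrm (indicator (space M))"
    using Cauchy_Schwarz[OF bdd_fun_abs[OF assms] bdd_fun_indicator[OF sets.top]] by (rule abs_le_D1)
  also have "nrm (indicator (space M)) = 1"
    by (simp add: nrm_def inner_prod_def prob_space flip: indicator_inter_arith)
  also have "nrm (\<lambda>x. \<bar>f x\<bar>) = nrm f" by (simp add: nrm_def inner_prod_def)
  finally show ?thesis by simp
qed

text \<open>A linear functional on a convex hull is bounded by its values at the generators. The
  contrapositive selects a single translate.\<close>

lemma Av_inner_le: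
  assumes "A \<in> Av L" "f \<in> bdd_fun" "g \<in> bdd_fun" "\<And>w. w \<in> L \<Longrightarrow> inner_prod g (koopman w f) \<le> c"
  shows "inner_prod g (A f) \<le> c"
  using assms(1)
proof (induction rule: Av.induct)
  case (cvx A B a)
  have "inner_prod g (a *\<^sub>R A f + (1 - a) *\<^sub>R B f) = a * inner_prod g (A f) + (1 - a) * inner_prod g (B f)"
    using cvx.hyps assms by (simp add: ip_add_right ip_scale_right)
  also have "\<dots> \<le> a * c + (1 - a) * c" using cvx by (intro add_mono mult_left_mono) auto
  also have "\<dots> = c" by (simp add: algebra_simps)
  finally show ?case .
qed (use assms in auto)

lemma bdd_fun_mult_prod:
  assumes "finite I" "g \<in> bdd_fun" "\<And>i. i \<in> I \<Longrightarrow> h i \<in> bdd_fun"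
  shows "(\<lambda>x. g x * (\<Prod>i\<in>I. h i x)) \<in> bdd_fun"
  using assms
proof (induction I rule: finite_induct)
  case (insert i I)
  then have "(\<lambda>x. (g x * (\<Prod>i\<in>I. h i x)) * h i x) \<in> bdd_fun"
    by (intro bdd_fun_mult[of "\<lambda>x. g x * (\<Prod>i\<in>I. h i x)"]) auto
  then show ?case using insert.hyps by (simp add: mult_ac)
qed simp

text \<open>The integral is linear in each \<open>A i f\<close> separately, so the averages are
  replaced by single translates one at a time: if no translate exceeded \<open>c\<close>, neither
  would the average.\<close>

lemma Av_select:
  assumes "finite I" "f \<in> bdd_fun" "g \<in> bdd_fun" "\<And>i. i \<in> I \<Longrightarrow> A i \<in> Av (L i)"
    "c < (LINT x|M. g x * (\<Prod>i\<in>I. A i f x))"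
  shows "\<exists>w. (\<forall>i\<in>I. w i \<in> L i) \<and> c < (LINT x|M. g x * (\<Prod>i\<in>I. koopman (w i) f x))"
  using assms
proof (induction I arbitrary: g rule: finite_induct)
  case empty
  then show ?case by simp
next
  case (insert j I)
  have Aj: "A j \<in> Av (L j)" using insert.prems by auto
  have "c < (LINT x|M. (g x * A j f x) * (\<Prod>i\<in>I. A i f x))"
    using insert.prems(4) insert.hyps by (simp add: mult.assoc)
  then obtain w where w: "\<And>i. i \<in> I \<Longrightarrow> w i \<in> L i"
    "c < (LINT x|M. (g x * A j f x) * (\<Prod>i\<in>I. koopman (w i) f x))"
    using insert.IH[of "\<lambda>x. g x * A j f x"] insert.prems Aj by (auto intro: bdd_fun_mult)
  define h where "h x = g x * (\<Prod>i\<in>I. koopman (w i) f x)" for x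
  have h: "h \<in> bdd_fun"
    unfolding h_def[abs_def] using insert by (intro bdd_fun_mult_prod) (auto intro: koopman_bdd_fun)
  have "c < inner_prod h (A j f)" using w(2) by (simp add: inner_prod_def h_def mult_ac)
  then have "\<not> (\<forall>u\<in>L j. inner_prod h (koopman u f) \<le> c)"
    using Av_inner_le[OF Aj insert.prems(1) h, of c] by fastforce
  then obtain u where u: "u \<in> L j" "c < inner_prod h (koopman u f)" by auto
  have "(\<Prod>i\<in>I. koopman ((w(j := u)) i) f x) = (\<Prod>i\<in>I. koopman (w i) f x)" for x
    using insert.hyps by (intro prod.cong) auto
  then have "c < (LINT x|M. g x * (\<Prod>i\<in>insert j I. koopman ((w(j := u)) i) f x))"
    using u insert.hyps by (simp add: inner_prod_def h_def mult_ac)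
  then show ?case using w u by (intro exI[of _ "w(j := u)"]) auto
qed

text \<open>Jensen's inequality for the power function, by integrating its tangent line at the mean
  \<open>a\<close>. The tangent bound is Bernoulli's inequality for \<open>g x / a\<close>, where
  nonnegativity of \<open>g\<close> enters.\<close>

lemma integral_power_ge:
  assumes "g \<in> bdd_fun" "\<And>x. 0 \<le> g x" "(LINT x|M. g x) > 0"
  shows "(LINT x|M. g x) ^ Suc n \<le> (LINT x|M. g x ^ Suc n)"
proof -
  define a where "a = (LINT x|M. g x)"
  have a: "a > 0" using assms by (simp add: a_def)
  have "a ^ Suc n + real (Suc n) * a ^ n * (g x - a) \<le> g x ^ Suc n" for x
  proof -
    have "1 + real (Suc n) * (g x / a - 1) \<le> (1 + (g x / a - 1)) ^ Suc n"
      by (rule Bernoulli_inequality) (use a assms in simp)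
    then have "a ^ Suc n * (1 + real (Suc n) * (g x / a - 1)) \<le> a ^ Suc n * (g x / a) ^ Suc n"
      using a by (intro mult_left_mono) auto
    also have "a ^ Suc n * (g x / a) ^ Suc n = g x ^ Suc n"
      using a by (simp flip: power_mult_distrib)
    also have "a ^ Suc n * (1 + real (Suc n) * (g x / a - 1)) = a ^ Suc n + real (Suc n) * a ^ n * (g x - a)"
      using a by (simp add: field_simps)
    finally show ?thesis .
  qed
  then have "(LINT x|M. a ^ Suc n + real (Suc n) * a ^ n * (g x - a)) \<le> (LINT x|M. g x ^ Suc n)"
    using bdd_fun_integrable[OF assms(1)] bdd_fun_integrable[OF bdd_fun_power[OF assms(1)]]
    by (intro integral_mono) auto
  moreover have "(LINT x|M. a ^ Suc n + real (Suc n) * a ^ n * (g x - a)) = a ^ Suc n"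
    using bdd_fun_integrable[OF assms(1)] by (simp add: prob_space a_def)
  ultimately show ?thesis by (simp add: a_def)
qed

text \<open>The semigroup enters only through sets \<open>L i\<close> that contain a suitable curve.
  Averaging along these curves makes each factor close to \<open>g\<close>, and near invariance of
  \<open>g\<close> compares the integral of \<open>f * g ^ m\<close> with that of
  \<open>g ^ (m + 1)\<close>, which Jensen's inequality bounds below. Finally
  \<open>Av_select\<close> returns from averages to single translates.\<close>

theorem multiple_recurrence_averages:
  assumes B: "B \<in> sets M" "measure M B > 0" and "m \<ge> 1" "\<epsilon> > 0"
  obtains k where "k > 0"
    "\<And>L. (\<And>i. i \<in> {1..m} \<Longrightarrow> \<exists>c D K. (\<forall>t. vpoly c D t \<in> mult_lattice k \<inter> L i) \<and> K > 0 \<and>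
        (\<forall>w\<in>mult_lattice K. \<exists>n. w = (\<Sum>j\<in>{1..D}. n j *s c j))) \<Longrightarrow>
      \<exists>w. (\<forall>i\<in>{1..m}. w i \<in> L i) \<and>
        measure M (B \<inter> (\<Inter>i\<in>{1..m}. T (w i) -` B \<inter> space M)) > measure M B ^ (m + 1) - \<epsilon>"
proof -
  define f :: "'a \<Rightarrow> real" where "f = indicator B"
  have fV: "f \<in> bdd_fun" unfolding f_def using B(1) by (rule bdd_fun_indicator)
  have f01: "0 \<le> f x \<and> f x \<le> 1" for x by (simp add: f_def indicator_def)
  have int_f: "(LINT x|M. f x) = measure M B"
    using B sets.sets_into_space[of B M] by (simp add: f_def Int_absorb2)
  have "inner_prod f f = (LINT x|M. f x)"
    unfolding inner_prod_def f_def by (rule Bochner_Integration.integral_cong) (auto simp: indicator_def)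
  then have f1: "nrm f \<le> 1" by (simp add: nrm_def int_f)
  \<comment> \<open>There are two approximations, each with error at most
    \<open>m * e\<close>.\<close>
  define e where "e = \<epsilon> / (4 * real m)"
  have e: "e > 0" "real m * e + real m * e < \<epsilon>" using \<open>m \<ge> 1\<close> \<open>\<epsilon> > 0\<close> by (auto simp: e_def)
  obtain k P where k: "k > 0" "P \<in> Av (mult_lattice k)"
    and inv: "\<And>w. w \<in> mult_lattice k \<Longrightarrow> nrm (koopman w (P f) - P f) \<le> e"
    and avgs: "\<And>c D K. \<lbrakk>\<And>t. vpoly c D t \<in> mult_lattice k; K > 0;
        \<And>w. w \<in> mult_lattice K \<Longrightarrow> \<exists>n. w = (\<Sum>j\<in>{1..D}. n j *s c j)\<rbrakk> \<Longrightarrow>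
      \<exists>A\<in>Av (range (\<lambda>t. vpoly c D (int t))). nrm (A f - P f) \<le> e"
    using polynomial_averages[OF fV f1 e(1)] by blast
  define g where "g = P f"
  have gV: "g \<in> bdd_fun" using k fV by (auto simp: g_def)
  have g01: "0 \<le> g x \<and> g x \<le> 1" for x unfolding g_def by (rule Av_unit[OF k(2) f01])
  have int_g: "(LINT x|M. g x) = measure M B"
    unfolding g_def int_f[symmetric] by (rule Av_integral[OF k(2) fV])
  obtain m' where m': "m = Suc m'" using \<open>m \<ge> 1\<close> by (cases m) auto
  have gmV: "(\<lambda>x. g x ^ m) \<in> bdd_fun" unfolding m' by (rule bdd_fun_power[OF gV])
  \<comment> \<open>Replacing \<open>g\<close> by its translate costs at most \<open>m\<close> times
    their L1 distance, as all values lie in \<open>[0, 1]\<close>; then both factors are translated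
    and invariance of the inner product applies.\<close>
  have "inner_prod (\<lambda>x. g x ^ m) (koopman w f) \<le> inner_prod (\<lambda>x. g x ^ m) f + real m * e"
    if w: "w \<in> mult_lattice k" for w
  proof -
    have wg: "koopman w (\<lambda>x. g x ^ m) = (\<lambda>x. koopman w g x ^ m)"
      using m' by (auto simp: koopman_def)
    have wgV: "koopman w g \<in> bdd_fun" using gV by (rule koopman_bdd_fun)
    have wgmV: "(\<lambda>x. koopman w g x ^ m) \<in> bdd_fun" unfolding m' by (rule bdd_fun_power[OF wgV])
    define d1 where "d1 = koopman w g - g"
    have d1: "d1 \<in> bdd_fun" "d1 x = koopman w g x - g x" for x
      unfolding d1_def by (simp_all add: wgV gV)
    define d2 where "d2 = (\<lambda>x. g x ^ m) - (\<lambda>x. koopman w g x ^ m)"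
    have d2: "d2 \<in> bdd_fun" "d2 x = g x ^ m - koopman w g x ^ m" for x
      unfolding d2_def by (simp_all add: wgmV gmV)
    have "inner_prod (\<lambda>x. g x ^ m) (koopman w f) - inner_prod (\<lambda>x. koopman w g x ^ m) (koopman w f)
      = inner_prod d2 (koopman w f)"
      unfolding d2_def by (rule ip_diff_left[symmetric]) (auto intro: gmV wgmV fV)
    also have "\<dots> \<le> (LINT x|M. real m * \<bar>d1 x\<bar>)"
      unfolding inner_prod_def
    proof (rule integral_mono)
      show "integrable M (\<lambda>x. d2 x * koopman w f x)"
        by (rule bdd_fun_integrable[OF bdd_fun_mult[OF d2(1) koopman_bdd_fun[OF fV]]])
      show "integrable M (\<lambda>x. real m * \<bar>d1 x\<bar>)"
        by (rule integrable_mult_right[OF bdd_fun_integrable[OF bdd_fun_abs[OF d1(1)]]])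
      fix x
      have "d2 x * koopman w f x \<le> \<bar>d2 x\<bar> * \<bar>koopman w f x\<bar>"
        using abs_ge_self[of "d2 x * koopman w f x"] by (simp only: abs_mult)
      also have "\<dots> \<le> \<bar>d2 x\<bar> * 1"
        using f01 by (intro mult_left_mono) (auto simp: koopman_def)
      also have "\<bar>d2 x\<bar> \<le> real m * \<bar>d1 x\<bar>"
        using norm_power_diff[of "g x" "koopman w g x" m] g01
        by (auto simp: koopman_def d1(2) d2(2) abs_minus_commute)
      finally show "d2 x * koopman w f x \<le> real m * \<bar>d1 x\<bar>" by simp
    qed
    also have "\<dots> = real m * (LINT x|M. \<bar>d1 x\<bar>)" by simp
    also have "\<dots> \<le> real m * e"
      using integral_abs_le_nrm[OF d1(1)] inv[OF w, folded g_def, folded d1_def]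
      by (intro mult_left_mono) linarith+
    finally show ?thesis using ip_U[OF gmV fV, of w] by (simp add: wg)
  qed
  \<comment> \<open>The bound for single translates of \<open>f\<close> passes to their convex
    combination \<open>g\<close>.\<close>
  then have "inner_prod (\<lambda>x. g x ^ m) g \<le> inner_prod (\<lambda>x. g x ^ m) f + real m * e"
    unfolding g_def by (intro Av_inner_le[OF k(2) fV]) (use gmV in \<open>auto simp: g_def\<close>)
  moreover have "measure M B ^ (m + 1) \<le> inner_prod (\<lambda>x. g x ^ m) g"
    using integral_power_ge[OF gV, of m] g01 B(2) by (simp add: int_g inner_prod_def mult.commute)
  ultimately have main: "measure M B ^ (m + 1) - real m * e \<le> inner_prod (\<lambda>x. g x ^ m) f" by simp
  show thesis
  proof
    show "k > 0" by fact
    fix L :: "nat \<Rightarrow> (int ^ 'd) set"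
    assume L: "\<And>i. i \<in> {1..m} \<Longrightarrow> \<exists>c D K. (\<forall>t. vpoly c D t \<in> mult_lattice k \<inter> L i) \<and> K > 0 \<and>
        (\<forall>w\<in>mult_lattice K. \<exists>n. w = (\<Sum>j\<in>{1..D}. n j *s c j))"
    have "\<exists>A\<in>Av (L i). nrm (A f - g) \<le> e" if "i \<in> {1..m}" for i
    proof -
      obtain c D K where c: "\<And>t. vpoly c D t \<in> mult_lattice k \<inter> L i" and K: "K > 0"
        "\<And>w. w \<in> mult_lattice K \<Longrightarrow> \<exists>n. w = (\<Sum>j\<in>{1..D}. n j *s c j)" using L[OF \<open>i \<in> {1..m}\<close>] by blast
      obtain A where "A \<in> Av (range (\<lambda>t. vpoly c D (int t)))" "nrm (A f - g) \<le> e"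
        using avgs[OF _ K] c unfolding g_def by blast
      then show ?thesis using Av_mono[of A _ "L i"] c by blast
    qed
    then obtain A where A: "\<And>i. i \<in> {1..m} \<Longrightarrow> A i \<in> Av (L i)"
      "\<And>i. i \<in> {1..m} \<Longrightarrow> nrm (A i f - g) \<le> e" by metis
    have AV: "A i f \<in> bdd_fun" if "i \<in> {1..m}" for i using A(1)[OF that] fV by auto
    define d where "d i = A i f - g" for i
    have d: "d i \<in> bdd_fun" "d i x = A i f x - g x" if "i \<in> {1..m}" for i x
      unfolding d_def using AV[OF that] gV by simp_all
    have int_d: "integrable M (\<lambda>x. \<bar>d i x\<bar>)" if "i \<in> {1..m}" for i
      by (rule bdd_fun_integrable[OF bdd_fun_abs[OF d(1)[OF that]]])
    have A01: "0 \<le> A i f x \<and> A i f x \<le> 1" if "i \<in> {1..m}" for i x using Av_unit[OF A(1)[OF that] f01] .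
    have fgV: "(\<lambda>x. g x ^ m * f x) \<in> bdd_fun" using gmV fV by (rule bdd_fun_mult)
    have fAV: "(\<lambda>x. f x * (\<Prod>i\<in>{1..m}. A i f x)) \<in> bdd_fun" using AV fV by (intro bdd_fun_mult_prod) auto
    have "inner_prod (\<lambda>x. g x ^ m) f - (LINT x|M. f x * (\<Prod>i\<in>{1..m}. A i f x))
      = (LINT x|M. g x ^ m * f x - f x * (\<Prod>i\<in>{1..m}. A i f x))"
      using fgV fAV by (simp add: inner_prod_def bdd_fun_integrable)
    also have "\<dots> \<le> (LINT x|M. (\<Sum>i\<in>{1..m}. \<bar>d i x\<bar>))"
    proof (rule integral_mono)
      show "integrable M (\<lambda>x. g x ^ m * f x - f x * (\<Prod>i\<in>{1..m}. A i f x))"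
        by (rule Bochner_Integration.integrable_diff[OF bdd_fun_integrable[OF fgV] bdd_fun_integrable[OF fAV]])
      show "integrable M (\<lambda>x. \<Sum>i\<in>{1..m}. \<bar>d i x\<bar>)"
        by (rule Bochner_Integration.integrable_sum[OF int_d])
      fix x
      define p where "p = (\<Prod>i\<in>{1..m}. g x) - (\<Prod>i\<in>{1..m}. A i f x)"
      have "g x ^ m * f x - f x * (\<Prod>i\<in>{1..m}. A i f x) = f x * p"
        by (simp add: p_def right_diff_distrib mult.commute)
      also have "\<dots> \<le> f x * \<bar>p\<bar>"
        using f01 by (intro mult_left_mono) auto
      also have "\<dots> \<le> 1 * \<bar>p\<bar>"
        using f01 by (intro mult_right_mono) auto
      \<comment> \<open>Products of numbers in \<open>[0, 1]\<close> differ by at most the sum of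
        the differences of their factors.\<close>
      also have "\<bar>p\<bar> \<le> (\<Sum>i\<in>{1..m}. \<bar>g x - A i f x\<bar>)"
        using norm_prod_diff[of "{1..m}" "\<lambda>_. g x" "\<lambda>i. A i f x"] g01 A01 by (auto simp: p_def)
      also have "\<dots> = (\<Sum>i\<in>{1..m}. \<bar>d i x\<bar>)"
        by (intro sum.cong) (auto simp: d(2) abs_minus_commute)
      finally show "g x ^ m * f x - f x * (\<Prod>i\<in>{1..m}. A i f x) \<le> (\<Sum>i\<in>{1..m}. \<bar>d i x\<bar>)"
        by simp
    qed
    also have "\<dots> = (\<Sum>i\<in>{1..m}. LINT x|M. \<bar>d i x\<bar>)"
      by (rule Bochner_Integration.integral_sum[OF int_d])
    also have "\<dots> \<le> (\<Sum>i\<in>{1..m}. e)"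
      by (rule sum_mono) (rule order_trans[OF integral_abs_le_nrm[OF d(1)] A(2)[folded d_def]])
    also have "\<dots> = real m * e" by simp
    finally have gt: "measure M B ^ (m + 1) - \<epsilon> < (LINT x|M. f x * (\<Prod>i\<in>{1..m}. A i f x))"
      using main e by linarith
    have "\<exists>w. (\<forall>i\<in>{1..m}. w i \<in> L i) \<and>
      measure M B ^ (m + 1) - \<epsilon> < (LINT x|M. f x * (\<Prod>i\<in>{1..m}. koopman (w i) f x))"
      by (rule Av_select[where A = A, OF finite_atLeastAtMost fV fV _ gt]) (rule A(1))
    then obtain w where w: "\<forall>i\<in>{1..m}. w i \<in> L i"
      "measure M B ^ (m + 1) - \<epsilon> < (LINT x|M. f x * (\<Prod>i\<in>{1..m}. koopman (w i) f x))"
      by blast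
    let ?C = "B \<inter> (\<Inter>i\<in>{1..m}. T (w i) -` B \<inter> space M)"
    have "(LINT x|M. f x * (\<Prod>i\<in>{1..m}. koopman (w i) f x)) = (LINT x|M. indicator ?C x)"
    proof (rule Bochner_Integration.integral_cong)
      fix x assume x: "x \<in> space M"
      show "f x * (\<Prod>i\<in>{1..m}. koopman (w i) f x) = indicator ?C x"
      proof (cases "x \<in> ?C")
        case True
        then have "x \<in> B" "\<forall>i\<in>{1..m}. T (w i) x \<in> B" by blast+
        then have "f x * (\<Prod>i\<in>{1..m}. koopman (w i) f x) = 1"
          using x by (simp add: f_def koopman_def)
        then show ?thesis unfolding indicator_simps(1)[OF True] .
      next
        case False
        then have "x \<notin> B \<or> (\<exists>i\<in>{1..m}. T (w i) x \<notin> B)" using x by blast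
        then have "f x = 0 \<or> (\<Prod>i\<in>{1..m}. koopman (w i) f x) = 0"
          using x by (auto simp: f_def koopman_def indicator_def)
        then show ?thesis unfolding indicator_simps(2)[OF False] by simp
      qed
    qed simp
    also have "\<dots> = measure M ?C"
      using B sets.sets_into_space[of B M] by (simp add: Int_absorb2 le_infI1)
    finally show "\<exists>w. (\<forall>i\<in>{1..m}. w i \<in> L i) \<and>
        measure M (B \<inter> (\<Inter>i\<in>{1..m}. T (w i) -` B \<inter> space M)) > measure M B ^ (m + 1) - \<epsilon>"
      using w by (intro exI[of _ w]) auto
  qed
qed

end

theorem theorem1p15:
  fixes \<Gamma> :: "(int ^ 'd \<Rightarrow> int ^ 'd) set"
    and s :: "nat \<Rightarrow> nat \<Rightarrow> (int ^ 'd \<Rightarrow> int ^ 'd)"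
    and r :: nat
    and M :: "'a measure"
    and T :: "int ^ 'd \<Rightarrow> 'a \<Rightarrow> 'a"
  assumes walks: "\<forall>j<r. polynomial_walk (s j)"
    and gen: "\<Gamma> = gen_semigroup {s j n | j n. j < r}"
    and prob: "prob_space M"
    and act: "mp_action M T"
  shows "\<forall>B \<in> sets M. measure M B > 0 \<longrightarrow>
    (\<forall>(m::nat) \<ge> 1. \<forall>\<epsilon>::real > 0. \<exists>k::nat > 0.
      \<forall>v :: nat \<Rightarrow> int ^ 'd.
        (\<forall>i\<in>{1..m}. (\<forall>l. int k dvd v i $ l) \<and>
                    hyperplane_fleeing ((\<lambda>\<gamma>. real_of_intvec (\<gamma> (v i))) ` \<Gamma>)) \<longrightarrow>
        (\<exists>\<gamma> :: nat \<Rightarrow> (int ^ 'd \<Rightarrow> int ^ 'd). (\<forall>i\<in>{1..m}. \<gamma> i \<in> \<Gamma>) \<and>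
           measure M (B \<inter> (\<Inter>i\<in>{1..m}. T (\<gamma> i (v i)) -` B \<inter> space M))
             > measure M B ^ (m + 1) - \<epsilon>))"
proof (intro ballI allI impI)
  fix B and m :: nat and \<epsilon> :: real
  assume B: "B \<in> sets M" "measure M B > 0" and m: "m \<ge> 1" and \<epsilon>: "\<epsilon> > 0"
  interpret mp_system M T
    by (intro mp_system.intro mp_system_axioms.intro prob act)
  obtain k where k: "k > 0" and rec:
    "\<And>L. (\<And>i. i \<in> {1..m} \<Longrightarrow> \<exists>c D K. (\<forall>t. vpoly c D t \<in> mult_lattice k \<inter> L i) \<and> K > 0 \<and>
        (\<forall>w\<in>mult_lattice K. \<exists>n. w = (\<Sum>j\<in>{1..D}. n j *s c j))) \<Longrightarrow>
      \<exists>w. (\<forall>i\<in>{1..m}. w i \<in> L i) \<and>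
        measure M (B \<inter> (\<Inter>i\<in>{1..m}. T (w i) -` B \<inter> space M)) > measure M B ^ (m + 1) - \<epsilon>"
    using multiple_recurrence_averages[OF B m \<epsilon>] by blast
  show "\<exists>k::nat > 0. \<forall>v :: nat \<Rightarrow> int ^ 'd.
        (\<forall>i\<in>{1..m}. (\<forall>l. int k dvd v i $ l) \<and>
                    hyperplane_fleeing ((\<lambda>\<gamma>. real_of_intvec (\<gamma> (v i))) ` \<Gamma>)) \<longrightarrow>
        (\<exists>\<gamma> :: nat \<Rightarrow> (int ^ 'd \<Rightarrow> int ^ 'd). (\<forall>i\<in>{1..m}. \<gamma> i \<in> \<Gamma>) \<and>
           measure M (B \<inter> (\<Inter>i\<in>{1..m}. T (\<gamma> i (v i)) -` B \<inter> space M))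
             > measure M B ^ (m + 1) - \<epsilon>)"
  proof (intro exI[of _ k] conjI allI impI k)
    fix v :: "nat \<Rightarrow> int ^ 'd"
    assume v: "\<forall>i\<in>{1..m}. (\<forall>l. int k dvd v i $ l) \<and>
      hyperplane_fleeing ((\<lambda>\<gamma>. real_of_intvec (\<gamma> (v i))) ` \<Gamma>)"
    \<comment> \<open>The orbits serve as the sets \<open>L i\<close>. The number \<open>k\<close>
      was fixed before \<open>v\<close>, as the uniformity of the claim requires.\<close>
    let ?L = "\<lambda>i. (\<lambda>\<gamma>. \<gamma> (v i)) ` \<Gamma>"
    have "\<exists>c D K. (\<forall>t. vpoly c D t \<in> mult_lattice k \<inter> ?L i) \<and> K > 0 \<and>
        (\<forall>w\<in>mult_lattice K. \<exists>n. w = (\<Sum>j\<in>{1..D}. n j *s c j))" if "i \<in> {1..m}" for i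
    proof -
      have "v i \<in> mult_lattice k" "hyperplane_fleeing ((\<lambda>\<gamma>. real_of_intvec (\<gamma> (v i))) ` \<Gamma>)"
        using v that by (auto simp: mult_lattice_def)
      then obtain c D where c: "\<And>t. vpoly c D t \<in> mult_lattice k" "\<And>t. vpoly c D t \<in> ?L i"
        "\<And>a. (\<And>j. j \<in> {1..D} \<Longrightarrow> a \<bullet> real_of_intvec (c j) = 0) \<Longrightarrow> a = 0"
        using polynomial_path[OF walks gen _ k, of "v i"] by blast
      obtain K where "K > 0" "\<And>w. w \<in> mult_lattice K \<Longrightarrow> \<exists>n. w = (\<Sum>j\<in>{1..D}. n j *s c j)"
        using int_span_contains_lattice[OF c(3)] by blast
      then show ?thesis using c by blast
    qed
    from rec[of ?L, OF this] obtain w where w: "\<forall>i\<in>{1..m}. w i \<in> ?L i"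
      "measure M (B \<inter> (\<Inter>i\<in>{1..m}. T (w i) -` B \<inter> space M)) > measure M B ^ (m + 1) - \<epsilon>" by blast
    then have "\<forall>i\<in>{1..m}. \<exists>\<gamma>\<in>\<Gamma>. w i = \<gamma> (v i)" by blast
    then obtain \<gamma> where \<gamma>: "\<forall>i\<in>{1..m}. \<gamma> i \<in> \<Gamma> \<and> w i = \<gamma> i (v i)" by metis
    then have "(\<Inter>i\<in>{1..m}. T (w i) -` B \<inter> space M) = (\<Inter>i\<in>{1..m}. T (\<gamma> i (v i)) -` B \<inter> space M)"
      by (intro INF_cong) auto
    then show "\<exists>\<gamma> :: nat \<Rightarrow> (int ^ 'd \<Rightarrow> int ^ 'd). (\<forall>i\<in>{1..m}. \<gamma> i \<in> \<Gamma>) \<and>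
       measure M (B \<inter> (\<Inter>i\<in>{1..m}. T (\<gamma> i (v i)) -` B \<inter> space M)) > measure M B ^ (m + 1) - \<epsilon>"
      using w(2) \<gamma> by (intro exI[of _ \<gamma>]) auto
  qed
qed

end
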